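(* Let $K$ be a field of characteristic $0$ and let $\delta$ be a Weitzenböck derivation such that $X_d$ is a Jordan basis of $\delta$ acting on $KX_d$ and $\delta$ has a $1\times 1$ Jordan cell corresponding to $x_d$ (so $\delta$ acts as a nilpotent linear operator on $KX_{d-1}$ and $\delta(x_d)=0$). Let $\{c_1,\ldots,c_k\}$ be a homogeneous generating set of the $K[X_{d-1}]^{\delta}$-module $(L_{d-1}'/L_{d-1}'')^{\delta}$ and let $\{f_1,\ldots,f_l\}$ be a generating set of the algebra of constants $K[X_{d-1}]^{\delta}$ consisting of homogeneous polynomials of positive degree. Then the $K[X_d]^{\delta}$-module $(L_d'/L_d'')^{\delta}$ is generated by the set $$\{c_1,\ldots,c_k\}\cup\{\pi(f_1),\ldots,\pi(f_l)\}.$$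
   Context: $X_m=\{x_1,\ldots,x_m\}$; $KX_m$ is the $K$-vector space with basis $X_m$; $K[X_m]$ is the polynomial algebra. $L_m$ is the free Lie algebra over $K$ freely generated by $X_m$, $L_m'=[L_m,L_m]$, $L_m''=[L_m',L_m']$, and $L_m/L_m''$ is the free metabelian Lie algebra, whose free generators are again denoted $x_1,\ldots,x_m$. $L_{d-1}/L_{d-1}''$ is regarded as the subalgebra of $L_d/L_d''$ generated by $x_1,\ldots,x_{d-1}$. A nonzero nilpotent linear operator $\delta$ of $KX_d$ extends uniquely to a derivation of $K[X_d]$ and of $L_d/L_d''$; these are called Weitzenböck derivations and denoted by the same symbol $\delta$. Since $\delta$ preserves $KX_{d-1}$, it also acts on $K[X_{d-1}]$ and $L_{d-1}/L_{d-1}''$. For any $\delta$-stable space $V$, $V^{\delta}=\{v\in V\mid\delta(v)=0\}$. Module structure: $L_m'/L_m''$ is a (right) $K[X_m]$-module via $u\,f(x_1,\ldots,x_m)=u\,f(\mathrm{ad}\,x_1,\ldots,\mathrm{ad}\,x_m)$ with $u\,\mathrm{ad}\,x_j=[u,x_j]$; by restriction, $(L_m'/L_m'')^{\delta}$ is a $K[X_m]^{\delta}$-module ($m=d-1,d$). Homogeneous means homogeneous with respect to the total degree in the variables. $\omega(K[X_{d-1}])$ is the augmentation ideal of $K[X_{d-1}]$, i.e. the ideal of all polynomials without constant term. The $K$-linear map $\pi:\omega(K[X_{d-1}])\to L_d'/L_d''$ is defined on monomials by $$\pi(x_{j_1}\cdots x_{j_n})=\sum_{k=1}^n[x_d,x_{j_k}]\,x_{j_1}\cdots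 x_{j_{k-1}}x_{j_{k+1}}\cdots x_{j_n},\quad n\geq 1,$$ where the polynomial factor acts through the module structure. *)

theory Defs
  imports
    "HOL-Library.Poly_Mapping"
    "HOL.Hull"
    "Jordan_Normal_Form.Jordan_Normal_Form"
begin

section \<open>Vector spaces of finitely supported functions\<close>

lift_definition pm_scale :: "'k::field \<Rightarrow> ('a \<Rightarrow>\<^sub>0 'k) \<Rightarrow> ('a \<Rightarrow>\<^sub>0 'k)"
  is "\<lambda>c f a. c * f a"
  by (rule finite_subset[rotated], assumption) auto

lemma lookup_pm_scale [simp]:
  "Poly_Mapping.lookup (pm_scale c f) a = c * Poly_Mapping.lookup f a"
  by transfer simp

global_interpretation pm: vector_space "pm_scale :: 'k::field \<Rightarrow> ('a \<Rightarrow>\<^sub>0 'k) \<Rightarrow> ('a \<Rightarrow>\<^sub>0 'k)"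
  by unfold_locales (rule poly_mapping_eqI; simp add: lookup_add algebra_simps)+


section \<open>Lie algebras\<close>

locale lie_algebra = vector_space scale
  for scale :: "'k::field \<Rightarrow> 'l::ab_group_add \<Rightarrow> 'l" (infixr \<open>*s\<close> 75) +
  fixes brac :: "'l \<Rightarrow> 'l \<Rightarrow> 'l"
  assumes brac_add_left: "brac (u + v) w = brac u w + brac v w"
    and brac_add_right: "brac w (u + v) = brac w u + brac w v"
    and brac_scale_left: "brac (c *s u) v = c *s brac u v"
    and brac_scale_right: "brac u (c *s v) = c *s brac u v"
    and brac_self: "brac u u = 0"
    and jacobi: "brac (brac u v) w + brac (brac v w) u + brac (brac w u) v = 0"
begin

definition derived :: "'l set \<Rightarrow> 'l set" where
  "derived S = span {brac u v | u v. u \<in> S \<and> v \<in> S}"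

definition lie_subalgebra :: "'l set \<Rightarrow> bool" where
  "lie_subalgebra S \<longleftrightarrow> subspace S \<and> (\<forall>u\<in>S. \<forall>v\<in>S. brac u v \<in> S)"

definition lie_generated :: "'l set \<Rightarrow> 'l set" where
  "lie_generated X = lie_subalgebra hull X"

definition lie_derivation :: "('l \<Rightarrow> 'l) \<Rightarrow> bool" where
  "lie_derivation D \<longleftrightarrow> Vector_Spaces.linear scale scale D \<and>
     (\<forall>u v. D (brac u v) = brac (D u) v + brac u (D v))"

lemma brac_zero_left [simp]: "brac 0 v = 0"
  using brac_add_left[of 0 0 v] by simp

lemma brac_zero_right [simp]: "brac v 0 = 0"
  using brac_add_right[of v 0 0] by simp

lemma brac_diff_left: "brac (u - v) w = brac u w - brac v w"
  using brac_add_left[of "u - v" v w] by simp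

lemma brac_diff_right: "brac w (u - v) = brac w u - brac w v"
  using brac_add_right[of w "u - v" v] by simp

lemma brac_antisym: "brac v u = - brac u v"
proof -
  have "0 = brac (u + v) (u + v)"
    by (simp only: brac_self)
  also have "\<dots> = brac v u + brac u v"
    by (simp only: brac_add_left brac_add_right brac_self[of u] brac_self[of v] add_0 add_0_right add.commute)
  finally show ?thesis
    by (metis eq_neg_iff_add_eq_0)
qed

text \<open>The derived algebra and the second derived algebra of the whole algebra are ideals.\<close>

lemma derived_ideal:
  assumes I: "\<And>u w. u \<in> I \<Longrightarrow> brac u w \<in> I" and u: "u \<in> derived I"
  shows "brac u w \<in> derived I"
  using u unfolding derived_def
proof (induction rule: span_induct_alt)
  case base
  show ?case by (simp add: span_zero)
next
  case (step c x y)
  then obtain a b where x: "x = brac a b" and ab: "a \<in> I" "b \<in> I" by blast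
  have "brac x w = - brac (brac b w) a - brac (brac w a) b"
    using jacobi[of a b w] unfolding x by (simp add: eq_neg_iff_add_eq_0 algebra_simps)
  also have "\<dots> = brac a (brac b w) + brac (brac a w) b"
    using brac_antisym[of a "brac b w"] brac_antisym[of w a] brac_diff_left[of 0 "brac a w" b]
    by simp
  also have "\<dots> \<in> span {brac u v | u v. u \<in> I \<and> v \<in> I}"
    using I ab by (intro span_add span_base) blast+
  finally show ?case
    using step.IH by (auto simp: brac_add_left brac_scale_left intro!: span_add span_scale)
qed

lemma second_derived_ideal:
  assumes "u \<in> derived (derived UNIV)"
  shows "brac u w \<in> derived (derived UNIV)" "brac w u \<in> derived (derived UNIV)"
proof -
  show *: "brac u w \<in> derived (derived UNIV)"
    by (intro derived_ideal assms) auto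
  show "brac w u \<in> derived (derived UNIV)"
    unfolding brac_antisym[of w u] using * span_neg unfolding derived_def by blast
qed

lemma derived_subspace: "subspace (derived S)"
  by (simp add: derived_def)

end


section \<open>The free Lie algebra\<close>

datatype 'v magma = Gen 'v | Br "'v magma" "'v magma"

primrec leaves :: "'v magma \<Rightarrow> nat" where
  "leaves (Gen v) = 1"
| "leaves (Br s t) = leaves s + leaves t"

text \<open>The product of the free nonassociative algebra, whose basis is the free magma: every
  word of length at least two splits uniquely as a product of two words.\<close>

lift_definition na_mult :: "('v magma \<Rightarrow>\<^sub>0 'k::field) \<Rightarrow> ('v magma \<Rightarrow>\<^sub>0 'k) \<Rightarrow> ('v magma \<Rightarrow>\<^sub>0 'k)"
  is "\<lambda>f g w. case w of Gen _ \<Rightarrow> 0 | Br s t \<Rightarrow> f s * g t"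
proof -
  fix f g :: "'v magma \<Rightarrow> 'k"
  assume fin: "finite {s. f s \<noteq> 0}" "finite {t. g t \<noteq> 0}"
  have "{w. (case w of Gen _ \<Rightarrow> 0 | Br s t \<Rightarrow> f s * g t) \<noteq> 0}
      \<subseteq> (\<lambda>(s, t). Br s t) ` ({s. f s \<noteq> 0} \<times> {t. g t \<noteq> 0})"
  proof
    fix w assume "w \<in> {w. (case w of Gen _ \<Rightarrow> 0 | Br s t \<Rightarrow> f s * g t) \<noteq> 0}"
    then show "w \<in> (\<lambda>(s, t). Br s t) ` ({s. f s \<noteq> 0} \<times> {t. g t \<noteq> 0})"
      by (cases w) auto
  qed
  then show "finite {w. (case w of Gen _ \<Rightarrow> 0 | Br s t \<Rightarrow> f s * g t) \<noteq> 0}"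
    using fin by (blast intro: finite_subset)
qed

lemma lookup_na_mult:
  "Poly_Mapping.lookup (na_mult f g) w =
     (case w of Gen _ \<Rightarrow> 0 | Br s t \<Rightarrow> Poly_Mapping.lookup f s * Poly_Mapping.lookup g t)"
  by transfer simp

lemma na_mult_simps:
  "na_mult (f + g) h = na_mult f h + na_mult g h"
  "na_mult h (f + g) = na_mult h f + na_mult h g"
  "na_mult (f - g) h = na_mult f h - na_mult g h"
  "na_mult h (f - g) = na_mult h f - na_mult h g"
  "na_mult (pm_scale c f) h = pm_scale c (na_mult f h)"
  "na_mult h (pm_scale c f) = pm_scale c (na_mult h f)"
  by (rule poly_mapping_eqI;
      simp add: lookup_na_mult lookup_add lookup_minus algebra_simps split: magma.splits)+

inductive_set lie_ideal :: "('v magma \<Rightarrow>\<^sub>0 'k::field) set" where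
  zero: "0 \<in> lie_ideal"
| add: "f \<in> lie_ideal \<Longrightarrow> g \<in> lie_ideal \<Longrightarrow> f + g \<in> lie_ideal"
| scale: "f \<in> lie_ideal \<Longrightarrow> pm_scale c f \<in> lie_ideal"
| mult_left: "f \<in> lie_ideal \<Longrightarrow> na_mult g f \<in> lie_ideal"
| mult_right: "f \<in> lie_ideal \<Longrightarrow> na_mult f g \<in> lie_ideal"
| self: "na_mult f f \<in> lie_ideal"
| jacobi: "na_mult (na_mult f g) h + na_mult (na_mult g h) f + na_mult (na_mult h f) g \<in> lie_ideal"

lemma lie_ideal_subspace: "pm.subspace lie_ideal"
  by (auto simp: pm.subspace_def intro: lie_ideal.intros)

definition lie_rel :: "('v magma \<Rightarrow>\<^sub>0 'k::field) \<Rightarrow> ('v magma \<Rightarrow>\<^sub>0 'k) \<Rightarrow> bool" where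
  "lie_rel f g \<longleftrightarrow> f - g \<in> lie_ideal"

lemma equivp_lie_rel: "equivp lie_rel"
proof (rule equivpI)
  show "reflp lie_rel"
    by (auto simp: reflp_def lie_rel_def intro: lie_ideal.zero)
  show "symp lie_rel"
    using pm.subspace_neg[OF lie_ideal_subspace]
    by (metis lie_rel_def minus_diff_eq sympI)
  show "transp lie_rel"
    using lie_ideal.add by (fastforce simp: lie_rel_def intro!: transpI)
qed

quotient_type (overloaded) ('v, 'k) free_lie = "'v magma \<Rightarrow>\<^sub>0 'k::field" / lie_rel
  by (rule equivp_lie_rel)

instantiation free_lie :: (type, field) ab_group_add
begin

lift_definition zero_free_lie :: "('a, 'b) free_lie" is 0 .

lift_definition plus_free_lie ::
  "('a, 'b) free_lie \<Rightarrow> ('a, 'b) free_lie \<Rightarrow> ('a, 'b) free_lie" is "(+)"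
  unfolding lie_rel_def using lie_ideal.add by (metis add_diff_add)

lift_definition uminus_free_lie :: "('a, 'b) free_lie \<Rightarrow> ('a, 'b) free_lie" is uminus
  unfolding lie_rel_def using pm.subspace_neg[OF lie_ideal_subspace]
  by (metis minus_diff_minus)

lift_definition minus_free_lie ::
  "('a, 'b) free_lie \<Rightarrow> ('a, 'b) free_lie \<Rightarrow> ('a, 'b) free_lie" is "(-)"
proof -
  fix f f' g g' :: "'a magma \<Rightarrow>\<^sub>0 'b"
  assume "lie_rel f f'" "lie_rel g g'"
  then have "(f - f') - (g - g') \<in> lie_ideal"
    unfolding lie_rel_def by (rule pm.subspace_diff[OF lie_ideal_subspace])
  then show "lie_rel (f - g) (f' - g')"
    by (simp add: lie_rel_def algebra_simps)
qed

instance
  by standard (transfer; simp add: lie_rel_def lie_ideal.zero algebra_simps)+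

end

lift_definition fl_scale :: "'k::field \<Rightarrow> ('v, 'k) free_lie \<Rightarrow> ('v, 'k) free_lie" is pm_scale
  unfolding lie_rel_def using lie_ideal.scale by (metis pm.scale_right_diff_distrib)

lift_definition fl_brac ::
  "('v, 'k::field) free_lie \<Rightarrow> ('v, 'k) free_lie \<Rightarrow> ('v, 'k) free_lie" is na_mult
proof -
  fix f f' g g' :: "'v magma \<Rightarrow>\<^sub>0 'k"
  assume "lie_rel f f'" "lie_rel g g'"
  then have "na_mult (f - f') g + na_mult f' (g - g') \<in> lie_ideal"
    unfolding lie_rel_def by (intro lie_ideal.add lie_ideal.mult_left lie_ideal.mult_right)
  then show "lie_rel (na_mult f g) (na_mult f' g')"
    by (simp add: lie_rel_def na_mult_simps)
qed

lift_definition fl_gen :: "'v \<Rightarrow> ('v, 'k::field) free_lie"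
  is "\<lambda>v. Poly_Mapping.single (Gen v) 1" .

lemma lie_rel_refl: "lie_rel f f"
  by (simp add: lie_rel_def lie_ideal.zero)

global_interpretation fl: lie_algebra
  "fl_scale :: 'k::field \<Rightarrow> ('v, 'k) free_lie \<Rightarrow> ('v, 'k) free_lie" fl_brac
proof
  fix u :: "('v, 'k) free_lie"
  show "fl_brac u u = 0"
    by transfer (simp add: lie_rel_def lie_ideal.self)
next
  fix u v w :: "('v, 'k) free_lie"
  show "fl_brac (fl_brac u v) w + fl_brac (fl_brac v w) u + fl_brac (fl_brac w u) v = 0"
    by transfer (simp add: lie_rel_def lie_ideal.jacobi)
qed (transfer; simp add: na_mult_simps algebra_simps lie_rel_refl)+


section \<open>The free metabelian Lie algebra\<close>

definition metab_rel :: "('v, 'k::field) free_lie \<Rightarrow> ('v, 'k) free_lie \<Rightarrow> bool" where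
  "metab_rel u v \<longleftrightarrow> u - v \<in> fl.derived (fl.derived UNIV)"

lemma metab_rel_refl: "metab_rel u u"
  by (simp add: metab_rel_def fl.subspace_0 fl.derived_subspace)

lemma equivp_metab_rel: "equivp metab_rel"
proof (rule equivpI)
  show "reflp metab_rel"
    by (simp add: reflp_def metab_rel_refl)
  show "symp metab_rel"
    using fl.subspace_neg[OF fl.derived_subspace]
    by (metis metab_rel_def minus_diff_eq sympI)
  show "transp metab_rel"
    using fl.subspace_add[OF fl.derived_subspace] by (fastforce simp: metab_rel_def intro!: transpI)
qed

quotient_type (overloaded) ('v, 'k) free_metab = "('v, 'k::field) free_lie" / metab_rel
  by (rule equivp_metab_rel)

instantiation free_metab :: (type, field) ab_group_add
begin

lift_definition zero_free_metab :: "('a, 'b) free_metab" is 0 .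

lift_definition plus_free_metab ::
  "('a, 'b) free_metab \<Rightarrow> ('a, 'b) free_metab \<Rightarrow> ('a, 'b) free_metab" is "(+)"
  unfolding metab_rel_def using fl.subspace_add[OF fl.derived_subspace] by (metis add_diff_add)

lift_definition uminus_free_metab :: "('a, 'b) free_metab \<Rightarrow> ('a, 'b) free_metab" is uminus
  unfolding metab_rel_def using fl.subspace_neg[OF fl.derived_subspace]
  by (metis minus_diff_minus)

lift_definition minus_free_metab ::
  "('a, 'b) free_metab \<Rightarrow> ('a, 'b) free_metab \<Rightarrow> ('a, 'b) free_metab" is "(-)"
proof -
  fix f f' g g' :: "('a, 'b) free_lie"
  assume "metab_rel f f'" "metab_rel g g'"
  then have "(f - f') - (g - g') \<in> fl.derived (fl.derived UNIV)"
    unfolding metab_rel_def by (rule fl.subspace_diff[OF fl.derived_subspace])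
  then show "metab_rel (f - g) (f' - g')"
    by (simp add: metab_rel_def algebra_simps)
qed

instance
  by standard (transfer; simp add: metab_rel_def fl.subspace_0 fl.derived_subspace algebra_simps)+

end

lift_definition fm_scale :: "'k::field \<Rightarrow> ('v, 'k) free_metab \<Rightarrow> ('v, 'k) free_metab" is fl_scale
  unfolding metab_rel_def using fl.subspace_scale[OF fl.derived_subspace]
  by (metis fl.scale_right_diff_distrib)

lift_definition fm_brac ::
  "('v, 'k::field) free_metab \<Rightarrow> ('v, 'k) free_metab \<Rightarrow> ('v, 'k) free_metab" is fl_brac
proof -
  fix f f' g g' :: "('v, 'k) free_lie"
  assume "metab_rel f f'" "metab_rel g g'"
  then have "fl_brac (f - f') g + fl_brac f' (g - g') \<in> fl.derived (fl.derived UNIV)"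
    unfolding metab_rel_def
    by (intro fl.subspace_add[OF fl.derived_subspace] fl.second_derived_ideal)
  then show "metab_rel (fl_brac f g) (fl_brac f' g')"
    by (simp add: metab_rel_def fl.brac_diff_left fl.brac_diff_right)
qed

lift_definition fm_gen :: "'v \<Rightarrow> ('v, 'k::field) free_metab" is fl_gen .

global_interpretation fm: lie_algebra
  "fm_scale :: 'k::field \<Rightarrow> ('v, 'k) free_metab \<Rightarrow> ('v, 'k) free_metab" fm_brac
proof
  fix a b :: 'k and u v w :: "('v, 'k) free_metab"
  show "fm_scale a (u + v) = fm_scale a u + fm_scale a v"
    by transfer (simp add: fl.scale_right_distrib metab_rel_refl)
  show "fm_scale (a + b) u = fm_scale a u + fm_scale b u"
    by transfer (simp add: fl.scale_left_distrib metab_rel_refl)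
  show "fm_scale a (fm_scale b u) = fm_scale (a * b) u"
    by transfer (simp add: metab_rel_refl)
  show "fm_scale 1 u = u"
    by transfer (simp add: metab_rel_refl)
  show "fm_brac (u + v) w = fm_brac u w + fm_brac v w"
    by transfer (simp add: fl.brac_add_left metab_rel_refl)
  show "fm_brac w (u + v) = fm_brac w u + fm_brac w v"
    by transfer (simp add: fl.brac_add_right metab_rel_refl)
  show "fm_brac (fm_scale a u) v = fm_scale a (fm_brac u v)"
    by transfer (simp add: fl.brac_scale_left metab_rel_refl)
  show "fm_brac u (fm_scale a v) = fm_scale a (fm_brac u v)"
    by transfer (simp add: fl.brac_scale_right metab_rel_refl)
  show "fm_brac u u = 0"
    by transfer (simp add: fl.brac_self metab_rel_refl)
  show "fm_brac (fm_brac u v) w + fm_brac (fm_brac v w) u + fm_brac (fm_brac w u) v = 0"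
    by transfer (simp add: fl.jacobi metab_rel_refl)
qed

primrec fm_word :: "'v magma \<Rightarrow> ('v, 'k::field) free_metab" where
  "fm_word (Gen v) = fm_gen v"
| "fm_word (Br s t) = fm_brac (fm_word s) (fm_word t)"

definition fm_homogeneous :: "nat \<Rightarrow> ('v, 'k::field) free_metab \<Rightarrow> bool" where
  "fm_homogeneous n u \<longleftrightarrow> u \<in> fm.span {fm_word t | t. leaves t = n}"

text \<open>For a set \<open>V\<close> of \<open>m\<close> free generators the subalgebra generated by \<open>V\<close> is a copy of the
  free metabelian algebra of rank \<open>m\<close>. The following set is its derived algebra.\<close>

definition fm_derived :: "'v set \<Rightarrow> ('v, 'k::field) free_metab set" where
  "fm_derived V = fm.derived (fm.lie_generated (fm_gen ` V))"


section \<open>Polynomials\<close>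

type_synonym ('v, 'k) mpoly = "('v \<Rightarrow>\<^sub>0 nat) \<Rightarrow>\<^sub>0 'k"

definition pvar :: "'v \<Rightarrow> ('v, 'k::field) mpoly" where
  "pvar v = Poly_Mapping.single (Poly_Mapping.single v 1) 1"

definition polys_in :: "'v set \<Rightarrow> ('v, 'k::field) mpoly set" where
  "polys_in V = {f. \<forall>m\<in>Poly_Mapping.keys f. Poly_Mapping.keys m \<subseteq> V}"

definition poly_homogeneous :: "nat \<Rightarrow> ('v, 'k::field) mpoly \<Rightarrow> bool" where
  "poly_homogeneous n f \<longleftrightarrow>
     (\<forall>m\<in>Poly_Mapping.keys f. (\<Sum>v\<in>Poly_Mapping.keys m. Poly_Mapping.lookup m v) = n)"

definition poly_derivation :: "(('v, 'k::field) mpoly \<Rightarrow> ('v, 'k) mpoly) \<Rightarrow> bool" where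
  "poly_derivation D \<longleftrightarrow> Vector_Spaces.linear pm_scale pm_scale D \<and>
     (\<forall>f g. D (f * g) = D f * g + f * D g)"

definition poly_subalgebra :: "('v, 'k::field) mpoly set \<Rightarrow> bool" where
  "poly_subalgebra A \<longleftrightarrow> pm.subspace A \<and> 1 \<in> A \<and> (\<forall>f\<in>A. \<forall>g\<in>A. f * g \<in> A)"

definition generates_algebra :: "('v, 'k::field) mpoly set \<Rightarrow> ('v, 'k) mpoly set \<Rightarrow> bool" where
  "generates_algebra A F \<longleftrightarrow> poly_subalgebra hull F = A"


section \<open>The module structure of the derived algebra\<close>

text \<open>The list \<open>vs\<close> enumerates the variables and fixes the order in which the operators
  \<open>ad v\<close> are applied. On the derived algebra these operators commute, so there the result does
  not depend on the order.\<close>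

definition ad_monomial ::
  "'v list \<Rightarrow> ('v, 'k::field) free_metab \<Rightarrow> ('v \<Rightarrow>\<^sub>0 nat) \<Rightarrow> ('v, 'k) free_metab" where
  "ad_monomial vs u m =
     fold (\<lambda>v. (\<lambda>w. fm_brac w (fm_gen v)) ^^ Poly_Mapping.lookup m v) vs u"

definition fm_act ::
  "'v list \<Rightarrow> ('v, 'k::field) free_metab \<Rightarrow> ('v, 'k) mpoly \<Rightarrow> ('v, 'k) free_metab" where
  "fm_act vs u f =
     (\<Sum>m\<in>Poly_Mapping.keys f. fm_scale (Poly_Mapping.lookup f m) (ad_monomial vs u m))"

definition fm_submodule ::
  "'v list \<Rightarrow> ('v, 'k::field) mpoly set \<Rightarrow> ('v, 'k) free_metab set \<Rightarrow> bool" where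
  "fm_submodule vs R N \<longleftrightarrow> 0 \<in> N \<and> (\<forall>u\<in>N. \<forall>w\<in>N. u + w \<in> N) \<and>
     (\<forall>u\<in>N. \<forall>f\<in>R. fm_act vs u f \<in> N)"

definition generates_module ::
  "'v list \<Rightarrow> ('v, 'k::field) mpoly set \<Rightarrow> ('v, 'k) free_metab set \<Rightarrow> ('v, 'k) free_metab set \<Rightarrow> bool"
  where "generates_module vs R N C \<longleftrightarrow> fm_submodule vs R hull C = N"

text \<open>The map \<open>\<pi>\<close>, with \<open>y\<close> in the role of the last variable. The \<open>n\<close> summands belonging to a
  monomial \<open>m\<close> of degree \<open>n\<close> are collected by variables: \<open>v\<close> occurs with multiplicity
  \<open>lookup m v\<close>. The formula with one summand for each position is proved below.\<close>

definition pi_map ::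
  "'v list \<Rightarrow> 'v \<Rightarrow> ('v, 'k::field) mpoly \<Rightarrow> ('v, 'k) free_metab" where
  "pi_map vs y f = (\<Sum>m\<in>Poly_Mapping.keys f. fm_scale (Poly_Mapping.lookup f m)
     (\<Sum>v\<in>Poly_Mapping.keys m. fm_scale (of_nat (Poly_Mapping.lookup m v))
        (fm_act vs (fm_brac (fm_gen y) (fm_gen v))
           (Poly_Mapping.single (m - Poly_Mapping.single v 1) 1))))"


section \<open>Weitzenboeck derivations\<close>

text \<open>The vector space with basis the set of variables is \<open>'v \<Rightarrow>\<^sub>0 'k\<close>; it is mapped
  to the linear forms of the polynomial algebra and of the free metabelian Lie algebra.\<close>

definition poly_linear_form :: "('v \<Rightarrow>\<^sub>0 'k::field) \<Rightarrow> ('v, 'k) mpoly" where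
  "poly_linear_form w = (\<Sum>v\<in>Poly_Mapping.keys w. pm_scale (Poly_Mapping.lookup w v) (pvar v))"

definition fm_linear_form :: "('v \<Rightarrow>\<^sub>0 'k::field) \<Rightarrow> ('v, 'k) free_metab" where
  "fm_linear_form w = (\<Sum>v\<in>Poly_Mapping.keys w. fm_scale (Poly_Mapping.lookup w v) (fm_gen v))"

definition weitzenboeck ::
  "(('v \<Rightarrow>\<^sub>0 'k::field) \<Rightarrow> ('v \<Rightarrow>\<^sub>0 'k)) \<Rightarrow> (('v, 'k) mpoly \<Rightarrow> ('v, 'k) mpoly)
     \<Rightarrow> (('v, 'k) free_metab \<Rightarrow> ('v, 'k) free_metab) \<Rightarrow> bool" where
  "weitzenboeck \<delta> \<delta>P \<delta>L \<longleftrightarrow>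
     Vector_Spaces.linear pm_scale pm_scale \<delta> \<and> \<delta> \<noteq> (\<lambda>_. 0) \<and> (\<exists>n. \<delta> ^^ n = (\<lambda>_. 0)) \<and>
     poly_derivation \<delta>P \<and> (\<forall>w. \<delta>P (poly_linear_form w) = poly_linear_form (\<delta> w)) \<and>
     fm.lie_derivation \<delta>L \<and> (\<forall>w. \<delta>L (fm_linear_form w) = fm_linear_form (\<delta> w))"

text \<open>The variables are \<open>x 1, \<dots>, x d\<close>, matrices are indexed from \<open>0\<close>, and the columns of the
  matrix of an operator are the images of the basis vectors. Hence inside a Jordan cell
  \<open>\<delta> (x (Suc j)) = a * x (Suc j) + x j\<close>, where \<open>a\<close> is the eigenvalue.\<close>

definition operator_matrix ::
  "(nat \<Rightarrow> 'v) \<Rightarrow> nat \<Rightarrow> (('v \<Rightarrow>\<^sub>0 'k::field) \<Rightarrow> ('v \<Rightarrow>\<^sub>0 'k)) \<Rightarrow> 'k mat" where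
  "operator_matrix x d \<delta> = mat d d (\<lambda>(i, j).
     Poly_Mapping.lookup (\<delta> (Poly_Mapping.single (x (Suc j)) 1)) (x (Suc i)))"

definition jordan_basis ::
  "(nat \<Rightarrow> 'v) \<Rightarrow> nat \<Rightarrow> (('v \<Rightarrow>\<^sub>0 'k::field) \<Rightarrow> ('v \<Rightarrow>\<^sub>0 'k)) \<Rightarrow> (nat \<times> 'k) list \<Rightarrow> bool"
  where "jordan_basis x d \<delta> cells \<longleftrightarrow>
     0 \<notin> fst ` set cells \<and> operator_matrix x d \<delta> = jordan_matrix cells"

definition poly_constants ::
  "(('v, 'k::field) mpoly \<Rightarrow> ('v, 'k) mpoly) \<Rightarrow> 'v set \<Rightarrow> ('v, 'k) mpoly set" where
  "poly_constants D V = {f \<in> polys_in V. D f = 0}"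

definition fm_derived_constants ::
  "(('v, 'k::field) free_metab \<Rightarrow> ('v, 'k) free_metab) \<Rightarrow> 'v set \<Rightarrow> ('v, 'k) free_metab set" where
  "fm_derived_constants D V = {u \<in> fm_derived V. D u = 0}"


section \<open>Consistency of the definitions\<close>

lemma pm_sum_single:
  "(\<Sum>a\<in>Poly_Mapping.keys f. Poly_Mapping.single a (Poly_Mapping.lookup f a)) = f"
proof (rule poly_mapping_eqI)
  fix k
  have "Poly_Mapping.lookup
      (\<Sum>a\<in>Poly_Mapping.keys f. Poly_Mapping.single a (Poly_Mapping.lookup f a)) k =
      (\<Sum>a\<in>Poly_Mapping.keys f. if a = k then Poly_Mapping.lookup f k else 0)"
    by (auto simp: lookup_sum lookup_single when_def intro!: sum.cong)
  also have "\<dots> = Poly_Mapping.lookup f k"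
    by (simp add: in_keys_iff)
  finally show "Poly_Mapping.lookup
      (\<Sum>a\<in>Poly_Mapping.keys f. Poly_Mapping.single a (Poly_Mapping.lookup f a)) k =
      Poly_Mapping.lookup f k" .
qed

lemma fl_generated_UNIV: "fl.lie_generated (range fl_gen) = (UNIV :: ('v, 'k::field) free_lie set)"
proof -
  have word: "abs_free_lie (Poly_Mapping.single t 1) \<in> S"
    if S: "fl.lie_subalgebra S" "range fl_gen \<subseteq> S" for S :: "('v, 'k) free_lie set" and t
  proof (induction t)
    case (Gen v)
    then show ?case using S(2) by (auto simp: fl_gen.abs_eq[symmetric])
  next
    case (Br s t)
    have "abs_free_lie (Poly_Mapping.single (Br s t) (1::'k)) =
        fl_brac (abs_free_lie (Poly_Mapping.single s 1)) (abs_free_lie (Poly_Mapping.single t 1))"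
      unfolding fl_brac.abs_eq
      by (rule arg_cong[where f = abs_free_lie], rule poly_mapping_eqI)
        (auto simp: lookup_na_mult lookup_single when_def split: magma.splits)
    then show ?case using Br S(1) by (simp add: fl.lie_subalgebra_def)
  qed
  have "u \<in> S" if S: "fl.lie_subalgebra S" "range fl_gen \<subseteq> S"
    for S :: "('v, 'k) free_lie set" and u
  proof -
    have sub: "fl.subspace S" using S(1) by (simp add: fl.lie_subalgebra_def)
    have single: "abs_free_lie (Poly_Mapping.single t c) \<in> S" for t c
    proof -
      have "abs_free_lie (Poly_Mapping.single t c) =
          fl_scale c (abs_free_lie (Poly_Mapping.single t 1))"
        unfolding fl_scale.abs_eq
        by (rule arg_cong[where f = abs_free_lie], rule poly_mapping_eqI)
          (auto simp: lookup_single when_def)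
      then show ?thesis using fl.subspace_scale[OF sub word[OF S]] by simp
    qed
    have "abs_free_lie (\<Sum>t\<in>A. Poly_Mapping.single t (h t)) \<in> S" if "finite A" for A h
      using that
    proof (induction A rule: finite_induct)
      case empty
      then show ?case using fl.subspace_0[OF sub] by (simp add: zero_free_lie.abs_eq)
    next
      case (insert t A)
      then show ?case
        using fl.subspace_add[OF sub single insert.IH]
        by (simp add: plus_free_lie.abs_eq)
    qed
    then have "abs_free_lie f \<in> S" for f
      using pm_sum_single[of f] by (metis finite_keys)
    then show ?thesis by (induction u rule: free_lie.abs_induct)
  qed
  then show ?thesis unfolding fl.lie_generated_def hull_def by blast
qed

lemma fm_generated_UNIV: "fm.lie_generated (range fm_gen) = (UNIV :: ('v, 'k::field) free_metab set)"
proof -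
  have "u \<in> S" if S: "fm.lie_subalgebra S" "range fm_gen \<subseteq> S"
    for S :: "('v, 'k) free_metab set" and u
  proof -
    let ?T = "{a. abs_free_metab a \<in> S}"
    have "fl.lie_subalgebra ?T"
      using S(1)
      by (auto simp: fl.lie_subalgebra_def fm.lie_subalgebra_def fl.subspace_def fm.subspace_def
          plus_free_metab.abs_eq[symmetric] fm_scale.abs_eq[symmetric] fm_brac.abs_eq[symmetric]
          zero_free_metab.abs_eq[symmetric])
    moreover have "range fl_gen \<subseteq> ?T"
      using S(2) by (auto simp: fm_gen.abs_eq[symmetric])
    ultimately have "?T = UNIV"
      using fl_generated_UNIV hull_minimal[of "range fl_gen" ?T fl.lie_subalgebra]
      unfolding fl.lie_generated_def by blast
    then show ?thesis by (induction u rule: free_metab.abs_induct) blast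
  qed
  then show ?thesis unfolding fm.lie_generated_def hull_def by blast
qed

lemma prod_list_pvar:
  "prod_list (map pvar vs) =
     Poly_Mapping.single (sum_list (map (\<lambda>v. Poly_Mapping.single v (1::nat)) vs)) (1::'k::field)"
  by (induction vs) (auto simp: pvar_def mult_single)

lemma lookup_sum_list_single:
  "Poly_Mapping.lookup (sum_list (map (\<lambda>v. Poly_Mapping.single v (1::nat)) vs)) v = count_list vs v"
  by (induction vs) (auto simp: lookup_add lookup_single when_def)

lemma fm_sum_list_count:
  assumes "finite A" "set js \<subseteq> A"
  shows "(\<Sum>v\<in>A. fm_scale (of_nat (count_list js v) :: 'k::field) (F v)) = sum_list (map F js)"
  using assms(2)
proof (induction js)
  case (Cons j js)
  have "(\<Sum>v\<in>A. fm_scale (of_nat (count_list (j # js) v) :: 'k) (F v)) =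
      (\<Sum>v\<in>A. fm_scale (of_nat (count_list js v)) (F v) + (if v = j then F j else 0))"
    by (intro sum.cong) (auto simp: fm.scale_left_distrib)
  also have "\<dots> = sum_list (map F js) + F j"
    using Cons assms(1) by (simp add: sum.distrib)
  finally show ?case by (simp add: add.commute)
qed simp

lemma pi_map_prod_list:
  "pi_map vs y (prod_list (map pvar js) :: ('v, 'k::field) mpoly) =
     (\<Sum>k<length js. fm_act vs (fm_brac (fm_gen y) (fm_gen (js ! k)))
        (prod_list (map pvar (take k js @ drop (Suc k) js))))"
proof -
  define M where "M xs = sum_list (map (\<lambda>v::'v. Poly_Mapping.single v (1::nat)) xs)" for xs
  define F :: "'v \<Rightarrow> ('v, 'k) free_metab" where "F v = fm_act vs (fm_brac (fm_gen y) (fm_gen v))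
    (Poly_Mapping.single (M js - Poly_Mapping.single v 1) 1)" for v
  have lookup_M: "Poly_Mapping.lookup (M xs) v = count_list xs v" for xs v
    unfolding M_def by (rule lookup_sum_list_single)
  have prod: "prod_list (map pvar xs) = Poly_Mapping.single (M xs) (1::'k)" for xs
    by (simp add: prod_list_pvar M_def)
  have keys: "Poly_Mapping.keys (M js) = set js"
    by (auto simp: in_keys_iff lookup_M count_list_0_iff)
  have "pi_map vs y (prod_list (map pvar js)) =
      (\<Sum>v\<in>set js. fm_scale (of_nat (count_list js v) :: 'k) (F v))"
    unfolding prod pi_map_def F_def by (simp add: keys lookup_M)
  also have "\<dots> = sum_list (map F js)"
    by (rule fm_sum_list_count) auto
  also have "\<dots> = (\<Sum>k<length js. F (js ! k))"
    by (simp add: sum_list_sum_nth atLeast0LessThan)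
  also have "\<dots> = (\<Sum>k<length js. fm_act vs (fm_brac (fm_gen y) (fm_gen (js ! k)))
        (prod_list (map pvar (take k js @ drop (Suc k) js))))"
  proof (rule sum.cong)
    fix k assume "k \<in> {..<length js}"
    then have "M js = M (take k js @ js ! k # drop (Suc k) js)"
      by (simp add: id_take_nth_drop[symmetric])
    then have "M js = M (take k js @ drop (Suc k) js) + Poly_Mapping.single (js ! k) 1"
      by (simp add: M_def add_ac)
    then show "F (js ! k) = fm_act vs (fm_brac (fm_gen y) (fm_gen (js ! k)))
        (prod_list (map pvar (take k js @ drop (Suc k) js)))"
      unfolding F_def prod by simp
  qed simp
  finally show ?thesis .
qed

end

theory Submission
  imports Defs
begin

text \<open>Let \<open>y\<close> be the last variable and \<open>u\<close> a constant in the derived algebra. The Fox derivatives embed the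
  derived algebra into a free module over the polynomial algebra, and its image consists of the
  cycles of the Koszul complex; in characteristic \<open>0\<close> both facts follow from Euler's identity. The \<open>y\<close>-component
  \<open>h\<close> of \<open>u\<close> is a constant polynomial for the derivation, hence so are its coefficients \<open>h\<^sub>n\<close> with
  respect to powers of \<open>y\<close>, and they have no constant term. The \<open>y\<close>-component of \<open>\<pi>(f)\<close> is the
  Euler operator applied to \<open>f\<close>, which is invertible on polynomials without constant term and
  commutes with the derivation; so there are constants \<open>g\<^sub>n\<close> in the other variables such that
  \<open>u - \<Sum> \<pi>(g\<^sub>n) y\<^sup>n\<close> has \<open>y\<close>-component \<open>0\<close>. Expanding the remaining components in powers
  of \<open>y\<close> writes this difference as \<open>\<Sum> w\<^sub>n y\<^sup>n\<close>, where the \<open>w\<^sub>n\<close> are constants of the derived algebra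
  in the other variables. Finally \<open>\<pi>(f g) = \<pi>(f) g + \<pi>(g) f\<close>, so generators of the algebra of
  constants suffice.\<close>

section \<open>Polynomials\<close>

lemma poly_mapping_single_induct [case_names zero single add]:
  assumes "P 0" "\<And>a c. P (Poly_Mapping.single a c)" "\<And>f g. P f \<Longrightarrow> P g \<Longrightarrow> P (f + g)"
  shows "P (f :: 'a \<Rightarrow>\<^sub>0 'b::comm_monoid_add)"
proof (induction f rule: update_induct)
  case const
  then show ?case by (rule assms(1))
next
  case (update f a b)
  have "Poly_Mapping.update a b f = Poly_Mapping.single a b + f"
    using update(1) by (intro poly_mapping_eqI)
      (auto simp: lookup_update lookup_add lookup_single when_def in_keys_iff)
  then show ?case using assms(2,3) update(3) by metis
qed

lemma pm_scale_single: "pm_scale c (Poly_Mapping.single a b) = Poly_Mapping.single a (c * b)"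
  by (rule poly_mapping_eqI) (simp add: lookup_single when_def)

lemma pm_scale_conv_mult: "pm_scale c (f :: ('v, 'k::field) mpoly) = Poly_Mapping.single 0 c * f"
proof (induction f rule: poly_mapping_single_induct)
  case (single a b)
  then show ?case by (simp add: pm_scale_single mult_single)
qed (simp_all add: pm.scale_right_distrib algebra_simps)

lemma pm_scale_mult_left: "pm_scale c f * (g :: ('v, 'k::field) mpoly) = pm_scale c (f * g)"
  and pm_scale_mult_right: "f * pm_scale c g = pm_scale c (f * g)"
  by (simp_all add: pm_scale_conv_mult mult_ac)

section \<open>Total degree and induction on monomials\<close>

definition mdeg :: "('v::finite \<Rightarrow>\<^sub>0 nat) \<Rightarrow> nat" where
  "mdeg m = (\<Sum>v\<in>UNIV. Poly_Mapping.lookup m v)"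

lemma mdeg_zero [simp]: "mdeg 0 = 0"
  by (simp add: mdeg_def)

lemma mdeg_add: "mdeg (m + n) = mdeg m + mdeg n"
  by (simp add: mdeg_def lookup_add sum.distrib)

lemma mdeg_single [simp]: "mdeg (Poly_Mapping.single v n) = n"
  by (simp add: mdeg_def lookup_single when_def)

lemma monomial_diff_add:
  "Poly_Mapping.lookup m v \<noteq> 0 \<Longrightarrow> m - Poly_Mapping.single v (1::nat) + Poly_Mapping.single v 1 = m"
  by (rule poly_mapping_eqI) (auto simp: lookup_add lookup_minus lookup_single when_def)

lemma mdeg_diff:
  assumes "Poly_Mapping.lookup m v \<noteq> 0"
  shows "mdeg m = Suc (mdeg (m - Poly_Mapping.single v 1))"
  using arg_cong[OF monomial_diff_add[OF assms], of mdeg] by (simp add: mdeg_add)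

lemma monomial_induct [case_names zero add]:
  fixes m :: "'v::finite \<Rightarrow>\<^sub>0 nat"
  assumes "P 0" "\<And>m v. P m \<Longrightarrow> P (m + Poly_Mapping.single v 1)"
  shows "P m"
proof (induction "mdeg m" arbitrary: m)
  case 0
  then have "m = 0" by (intro poly_mapping_eqI) (simp add: mdeg_def)
  then show ?case using assms(1) by simp
next
  case (Suc n)
  then obtain v where v: "Poly_Mapping.lookup m v \<noteq> 0"
    by (force simp: mdeg_def)
  then show ?case
    using Suc assms(2)[of "m - Poly_Mapping.single v 1" v] mdeg_diff[OF v] monomial_diff_add[OF v] by simp
qed

lemma pvar_mult_single:
  "pvar v * Poly_Mapping.single m c = Poly_Mapping.single (m + Poly_Mapping.single v 1) c"
  by (simp add: pvar_def mult_single add.commute)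

text \<open>This form suits operators whose behaviour is known on products with one variable, such
  as derivations and the module action.\<close>

lemma mpoly_induct [case_names const add pvar]:
  fixes f :: "('v::finite, 'k::field) mpoly"
  assumes const: "\<And>c. P (Poly_Mapping.single 0 c)"
    and add: "\<And>f g. P f \<Longrightarrow> P g \<Longrightarrow> P (f + g)"
    and pvar: "\<And>v f. P f \<Longrightarrow> P (pvar v * f)"
  shows "P f"
proof (induction f rule: poly_mapping_single_induct)
  case (single m c)
  show ?case
  proof (induction m rule: monomial_induct)
    case (add m v)
    then show ?case using pvar[of "Poly_Mapping.single m c" v] by (simp only: pvar_mult_single)
  qed (rule const)
qed (use const[of 0] add in auto)

lemma lookup_pvar_mult:
  "Poly_Mapping.lookup (pvar v * f) m =
     (if Poly_Mapping.lookup m v = 0 then 0 else Poly_Mapping.lookup f (m - Poly_Mapping.single v 1))"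
proof (induction f rule: poly_mapping_single_induct)
  case (single a c)
  have "a + Poly_Mapping.single v 1 = m \<longleftrightarrow>
      Poly_Mapping.lookup m v \<noteq> 0 \<and> a = m - Poly_Mapping.single v 1"
    using monomial_diff_add[of m v] by (auto simp: lookup_add)
  then show ?case by (auto simp: pvar_mult_single lookup_single when_def)
qed (auto simp: lookup_add algebra_simps)

lemma lookup_pvar_mult_add [simp]:
  "Poly_Mapping.lookup (pvar v * f) (m + Poly_Mapping.single v 1) = Poly_Mapping.lookup f m"
  by (simp add: lookup_pvar_mult lookup_add)

section \<open>Partial derivatives, weights by degree, coefficients in one variable\<close>

lift_definition pdiff :: "'v \<Rightarrow> ('v, 'k::field) mpoly \<Rightarrow> ('v, 'k) mpoly"
  is "\<lambda>v f m. of_nat (Suc (Poly_Mapping.lookup m v)) * f (m + Poly_Mapping.single v 1)"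
proof -
  fix v and f :: "('v \<Rightarrow>\<^sub>0 nat) \<Rightarrow> 'k"
  assume "finite {m. f m \<noteq> 0}"
  then have "finite ((\<lambda>m. m + Poly_Mapping.single v 1) -` {m. f m \<noteq> 0})"
    by (rule finite_vimageI) (simp add: inj_def)
  then show "finite {m. of_nat (Suc (Poly_Mapping.lookup m v)) * f (m + Poly_Mapping.single v 1) \<noteq> 0}"
    by (rule rev_finite_subset) auto
qed

text \<open>The homogeneous component of degree \<open>n\<close> is multiplied by
  \<open>r n\<close>. The choice \<open>of_nat\<close> is the Euler operator; reciprocal weights
  serve to invert it and its shifts by a constant.\<close>

lift_definition deg_scale ::
  "(nat \<Rightarrow> 'k) \<Rightarrow> ('v::finite, 'k::field) mpoly \<Rightarrow> ('v, 'k) mpoly"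
  is "\<lambda>r f m. r (mdeg m) * f m"
  by (rule finite_subset[rotated], assumption) auto

text \<open>With \<open>f\<close> viewed as a polynomial in \<open>v\<close> over the other
  variables, this is its \<open>n\<close>-th coefficient; the test on the exponent makes the result
  free of \<open>v\<close>.\<close>

lift_definition pcoeff :: "'v \<Rightarrow> nat \<Rightarrow> ('v, 'k::field) mpoly \<Rightarrow> ('v, 'k) mpoly"
  is "\<lambda>v n f m. if Poly_Mapping.lookup m v = 0 then f (m + Poly_Mapping.single v n) else 0"
proof -
  fix v n and f :: "('v \<Rightarrow>\<^sub>0 nat) \<Rightarrow> 'k"
  assume "finite {m. f m \<noteq> 0}"
  then have "finite ((\<lambda>m. m + Poly_Mapping.single v n) -` {m. f m \<noteq> 0})"
    by (rule finite_vimageI) (simp add: inj_def)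
  then show "finite {m. (if Poly_Mapping.lookup m v = 0 then f (m + Poly_Mapping.single v n) else 0) \<noteq> 0}"
    by (rule rev_finite_subset) auto
qed

lemmas lookup_pdiff = pdiff.rep_eq
lemmas lookup_deg_scale = deg_scale.rep_eq
lemmas lookup_pcoeff = pcoeff.rep_eq

lemma pdiff_zero [simp]: "pdiff v 0 = 0"
  and deg_scale_zero [simp]: "deg_scale r 0 = 0"
  and pcoeff_zero [simp]: "pcoeff v n 0 = 0"
  by (rule poly_mapping_eqI; simp add: lookup_pdiff lookup_deg_scale lookup_pcoeff)+

text \<open>The names \<open>f'\<close> and \<open>g'\<close> in the second equation keep its finite
  type of variables away from the other two.\<close>

lemma pdiff_add: "pdiff v (f + g) = pdiff v f + pdiff v g"
  and deg_scale_add: "deg_scale r (f' + g') = deg_scale r f' + deg_scale r g'"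
  and pcoeff_add: "pcoeff v n (f + g) = pcoeff v n f + pcoeff v n g"
  by (rule poly_mapping_eqI;
      simp add: lookup_pdiff lookup_deg_scale lookup_pcoeff lookup_add algebra_simps)+

lemma pdiff_uminus: "pdiff v (- f) = - pdiff v f"
  and deg_scale_uminus: "deg_scale r (- f') = - deg_scale r f'"
  by (rule poly_mapping_eqI; simp add: lookup_pdiff lookup_deg_scale)+

lemma pdiff_pm_scale: "pdiff v (pm_scale c f) = pm_scale c (pdiff v f)"
  and deg_scale_pm_scale: "deg_scale r (pm_scale c f') = pm_scale c (deg_scale r f')"
  and pcoeff_pm_scale: "pcoeff v n (pm_scale c f) = pm_scale c (pcoeff v n f)"
  by (rule poly_mapping_eqI; simp add: lookup_pdiff lookup_deg_scale lookup_pcoeff)+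

lemma pdiff_sum: "pdiff v (\<Sum>i\<in>I. h i) = (\<Sum>i\<in>I. pdiff v (h i))"
  by (induction I rule: infinite_finite_induct) (auto simp: pdiff_add)

lemma deg_scale_sum: "deg_scale r (\<Sum>i\<in>I. h i) = (\<Sum>i\<in>I. deg_scale r (h i))"
  by (induction I rule: infinite_finite_induct) (auto simp: deg_scale_add)

lemma pcoeff_sum: "pcoeff v n (\<Sum>i\<in>I. h i) = (\<Sum>i\<in>I. pcoeff v n (h i))"
  by (induction I rule: infinite_finite_induct) (auto simp: pcoeff_add)

lemma pdiff_const [simp]: "pdiff v (Poly_Mapping.single 0 c) = 0"
proof (rule poly_mapping_eqI)
  fix m
  have "m + Poly_Mapping.single v (1::nat) \<noteq> 0"
    by (metis add_eq_0_iff_both_eq_0 lookup_add lookup_single_eq lookup_zero one_neq_zero)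
  then show "Poly_Mapping.lookup (pdiff v (Poly_Mapping.single 0 c)) m = Poly_Mapping.lookup 0 m"
    by (simp add: lookup_pdiff lookup_single when_def)
qed

lemma pdiff_one: "pdiff v 1 = 0"
  using pdiff_const[of v 1] by simp

lemma pdiff_single:
  "pdiff v (Poly_Mapping.single m c) =
     Poly_Mapping.single (m - Poly_Mapping.single v 1) (of_nat (Poly_Mapping.lookup m v) * c)"
proof (rule poly_mapping_eqI)
  fix m'
  show "Poly_Mapping.lookup (pdiff v (Poly_Mapping.single m c)) m' = Poly_Mapping.lookup
      (Poly_Mapping.single (m - Poly_Mapping.single v 1) (of_nat (Poly_Mapping.lookup m v) * c)) m'"
  proof (cases "m = m' + Poly_Mapping.single v 1")
    case True
    then show ?thesis by (simp add: lookup_pdiff lookup_add)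
  next
    case False
    then have "Poly_Mapping.lookup m v = 0 \<or> m - Poly_Mapping.single v 1 \<noteq> m'"
      using monomial_diff_add[of m v] by auto
    with False show ?thesis by (auto simp: lookup_pdiff lookup_single when_def)
  qed
qed

lemma pdiff_pvar_mult: "pdiff w (pvar v * f) = (if v = w then f else 0) + pvar v * pdiff w f"
proof (rule poly_mapping_eqI)
  fix m
  \<comment> \<open>Subtraction of exponents is truncated. It commutes with the addition for
    distinct variables; for equal ones a zero exponent is a separate case.\<close>
  have "m - Poly_Mapping.single v 1 + Poly_Mapping.single w 1 =
      m + Poly_Mapping.single w 1 - Poly_Mapping.single v (1::nat)"
    if "v \<noteq> w"
    using that by (intro poly_mapping_eqI) (auto simp: lookup_add lookup_minus lookup_single when_def)
  moreover have "of_nat (Suc (Poly_Mapping.lookup m w - 1)) = (of_nat (Poly_Mapping.lookup m w) :: 'b)"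
    if "Poly_Mapping.lookup m w \<noteq> 0"
    using that by simp
  ultimately show "Poly_Mapping.lookup (pdiff w (pvar v * f)) m =
      Poly_Mapping.lookup ((if v = w then f else 0) + pvar v * pdiff w f) m"
    using monomial_diff_add[of m v]
    by (auto simp: lookup_pdiff lookup_pvar_mult lookup_add lookup_minus lookup_single when_def
        simp del: of_nat_Suc) (simp_all add: distrib_right)
qed

lemma pdiff_mult: "pdiff w (f * g) = pdiff w f * g + f * pdiff w (g :: ('v::finite, 'k::field) mpoly)"
proof (induction f rule: mpoly_induct)
  case (const c)
  show ?case by (simp add: pm_scale_conv_mult[symmetric] pdiff_pm_scale)
qed (simp_all add: pdiff_add pdiff_pvar_mult mult.assoc distrib_left distrib_right)

text \<open>Multiplication by a variable raises degrees by one. Differentiation lowers them in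
  \<open>pdiff_deg_scale\<close>, so the composite \<open>pvar v * pdiff w f\<close> commutes with
  all weights.\<close>

lemma deg_scale_pvar_mult: "deg_scale r (pvar v * f) = pvar v * deg_scale (\<lambda>n. r (Suc n)) f"
  by (rule poly_mapping_eqI) (auto simp: lookup_deg_scale lookup_pvar_mult mdeg_diff[of _ v])

lemma pdiff_deg_scale: "pdiff v (deg_scale r f) = deg_scale (\<lambda>n. r (Suc n)) (pdiff v f)"
  by (rule poly_mapping_eqI) (auto simp: lookup_pdiff lookup_deg_scale mdeg_add)

text \<open>On a monomial \<open>pvar v * pdiff v\<close> multiplies by the exponent of
  \<open>v\<close>, and the exponents add up to the degree.\<close>

lemma euler_identity:
  "(\<Sum>v\<in>UNIV. pvar v * pdiff v f) = deg_scale of_nat (f :: ('v::finite, 'k::field) mpoly)"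
proof (rule poly_mapping_eqI)
  fix m
  have "Poly_Mapping.lookup (pvar v * pdiff v f) m =
      of_nat (Poly_Mapping.lookup m v) * Poly_Mapping.lookup f m" for v
    using monomial_diff_add[of m v]
    by (auto simp: lookup_pvar_mult lookup_pdiff lookup_minus)
  then show "Poly_Mapping.lookup (\<Sum>v\<in>UNIV. pvar v * pdiff v f) m =
      Poly_Mapping.lookup (deg_scale of_nat f) m"
    by (simp add: lookup_sum lookup_deg_scale mdeg_def sum_distrib_right)
qed

lemma pdiff_commute: "pdiff v (pdiff w f) = pdiff w (pdiff v (f :: ('v::finite, 'k::field) mpoly))"
  by (induction f rule: mpoly_induct) (auto simp: pdiff_add pdiff_pvar_mult)

lemma pcoeff_pvar_mult: "v \<noteq> y \<Longrightarrow> pcoeff y n (pvar v * f) = pvar v * pcoeff y n f"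
proof (rule poly_mapping_eqI)
  fix m
  assume "v \<noteq> y"
  moreover from this have "m - Poly_Mapping.single v 1 + Poly_Mapping.single y n =
      m + Poly_Mapping.single y n - Poly_Mapping.single v 1"
    by (intro poly_mapping_eqI) (auto simp: lookup_add lookup_minus lookup_single when_def)
  ultimately show "Poly_Mapping.lookup (pcoeff y n (pvar v * f)) m =
      Poly_Mapping.lookup (pvar v * pcoeff y n f) m"
    by (auto simp: lookup_pcoeff lookup_pvar_mult lookup_add lookup_minus lookup_single when_def)
qed

lemma pcoeff_pvar_mult_same: "pcoeff y (Suc n) (pvar y * f) = pcoeff y n f"
proof (rule poly_mapping_eqI)
  fix m
  have "m + Poly_Mapping.single y (Suc n) = (m + Poly_Mapping.single y n) + Poly_Mapping.single y 1"
    by (simp add: add.assoc single_add[symmetric])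
  then show "Poly_Mapping.lookup (pcoeff y (Suc n) (pvar y * f)) m = Poly_Mapping.lookup (pcoeff y n f) m"
    by (simp only: lookup_pcoeff lookup_pvar_mult_add)
qed

lemma pcoeff_pdiff: "v \<noteq> y \<Longrightarrow> pcoeff y n (pdiff v f) = pdiff v (pcoeff y n f)"
  by (rule poly_mapping_eqI)
    (auto simp: lookup_pcoeff lookup_pdiff lookup_add lookup_single add_ac)

lemma pcoeff_in_polys: "pcoeff y n f \<in> polys_in (- {y})"
  by (auto simp: polys_in_def in_keys_iff lookup_pcoeff split: if_splits)

lemma lookup_pvar_power_mult:
  "Poly_Mapping.lookup (pvar v ^ n * f) m =
     (if Poly_Mapping.lookup m v < n then 0 else Poly_Mapping.lookup f (m - Poly_Mapping.single v n))"
proof (induction n arbitrary: m)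
  case (Suc n)
  have "m - Poly_Mapping.single v 1 - Poly_Mapping.single v n = m - Poly_Mapping.single v (Suc n)"
    by (rule poly_mapping_eqI) (auto simp: lookup_minus lookup_single when_def)
  then show ?case
    by (auto simp: mult.assoc lookup_pvar_mult Suc lookup_minus)
qed simp

text \<open>Allowing every sufficiently large bound lets several polynomials share one.\<close>

lemma pcoeff_expansion:
  obtains N where "\<And>M. N \<le> M \<Longrightarrow> (f :: ('v, 'k::field) mpoly) = (\<Sum>n<M. pvar y ^ n * pcoeff y n f)"
proof -
  \<comment> \<open>The inserted 0 keeps the maximum defined for the zero polynomial.\<close>
  define N where "N = Suc (Max (insert 0 ((\<lambda>m. Poly_Mapping.lookup m y) ` Poly_Mapping.keys f)))"
  have N: "Poly_Mapping.lookup m y < N" if "Poly_Mapping.lookup f m \<noteq> 0" for m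
    unfolding N_def less_Suc_eq_le using that by (intro Max_ge) (auto simp: in_keys_iff)
  have "f = (\<Sum>n<M. pvar y ^ n * pcoeff y n f)" if "N \<le> M" for M
  proof (rule poly_mapping_eqI)
    fix m :: "'v \<Rightarrow>\<^sub>0 nat"
    have *: "m - Poly_Mapping.single y n + Poly_Mapping.single y n = m" if "n = Poly_Mapping.lookup m y"
      for n :: nat
      using that by (intro poly_mapping_eqI) (auto simp: lookup_minus lookup_add lookup_single when_def)
    have "Poly_Mapping.lookup (pvar y ^ n * pcoeff y n f) m =
        (if n = Poly_Mapping.lookup m y then Poly_Mapping.lookup f m else 0)" for n
      using * by (auto simp: lookup_pvar_power_mult lookup_pcoeff lookup_minus)
    then show "Poly_Mapping.lookup f m = Poly_Mapping.lookup (\<Sum>n<M. pvar y ^ n * pcoeff y n f) m"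
      using N[of m] that by (cases "Poly_Mapping.lookup f m = 0") (auto simp: lookup_sum)
  qed
  then show ?thesis by (rule that)
qed

lemma pdiff_polys_in: "f \<in> polys_in (- {y}) \<Longrightarrow> pdiff y f = 0"
proof (rule poly_mapping_eqI)
  fix m
  assume "f \<in> polys_in (- {y})"
  moreover have "y \<in> Poly_Mapping.keys (m + Poly_Mapping.single y (1::nat))"
    by (simp add: in_keys_iff lookup_add)
  ultimately have "m + Poly_Mapping.single y 1 \<notin> Poly_Mapping.keys f"
    unfolding polys_in_def by blast
  then show "Poly_Mapping.lookup (pdiff y f) m = Poly_Mapping.lookup 0 m"
    by (simp add: lookup_pdiff in_keys_iff)
qed

section \<open>Polynomials in a given set of variables\<close>

lemma polys_in_deg_scale: "f \<in> polys_in V \<Longrightarrow> deg_scale r f \<in> polys_in V"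
  by (auto simp: polys_in_def in_keys_iff lookup_deg_scale)

lemma polys_in_pdiff:
  assumes "f \<in> polys_in V"
  shows "pdiff v f \<in> polys_in V"
  unfolding polys_in_def mem_Collect_eq
proof
  fix m assume "m \<in> Poly_Mapping.keys (pdiff v f)"
  then have "m + Poly_Mapping.single v 1 \<in> Poly_Mapping.keys f"
    by (auto simp: in_keys_iff lookup_pdiff)
  then have "Poly_Mapping.keys (m + Poly_Mapping.single v 1) \<subseteq> V"
    using assms by (auto simp: polys_in_def)
  then show "Poly_Mapping.keys m \<subseteq> V"
    by (auto simp: in_keys_iff lookup_add subset_iff)
qed

lemma poly_subalgebra_polys_in: "poly_subalgebra (polys_in V)"
proof -
  have "f + g \<in> polys_in V" if "f \<in> polys_in V" "g \<in> polys_in V" for f g :: "('a, 'b) mpoly"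
    using that keys_add[of f g] by (auto simp: polys_in_def)
  moreover have "f * g \<in> polys_in V" if "f \<in> polys_in V" "g \<in> polys_in V" for f g :: "('a, 'b) mpoly"
    unfolding polys_in_def mem_Collect_eq
  proof
    fix m assume "m \<in> Poly_Mapping.keys (f * g)"
    then obtain a b where "m = a + b" "a \<in> Poly_Mapping.keys f" "b \<in> Poly_Mapping.keys g"
      using keys_mult[of f g] by blast
    then show "Poly_Mapping.keys m \<subseteq> V"
      using that keys_add[of a b] unfolding polys_in_def by blast
  qed
  moreover have "pm_scale c f \<in> polys_in V" if "f \<in> polys_in V" for c and f :: "('a, 'b) mpoly"
    using that by (simp add: polys_in_def in_keys_iff)
  moreover have "0 \<in> polys_in V" "1 \<in> polys_in V"
    by (simp_all add: polys_in_def)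
  ultimately show ?thesis
    unfolding poly_subalgebra_def pm.subspace_def by blast
qed

section \<open>Linear derivations of polynomials\<close>

text \<open>Column \<open>w\<close> of the matrix \<open>A\<close> is the image of the variable
  \<open>w\<close>.\<close>

locale linear_poly_derivation =
  fixes D :: "('v::finite, 'k::field) mpoly \<Rightarrow> ('v, 'k) mpoly" and A :: "'v \<Rightarrow> 'v \<Rightarrow> 'k"
  assumes derivation: "poly_derivation D"
    and pvar: "D (pvar w) = (\<Sum>v\<in>UNIV. pm_scale (A v w) (pvar v))"
begin

lemma add: "D (f + g) = D f + D g"
  and scale: "D (pm_scale c f) = pm_scale c (D f)"
  and mult: "D (f * g) = D f * g + f * D g"
  using derivation by (auto simp: poly_derivation_def Vector_Spaces.linear_iff)

lemma zero [simp]: "D 0 = 0"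
  using add[of 0 0] by simp

lemma one [simp]: "D 1 = 0"
  using mult[of 1 1] by simp

lemma const [simp]: "D (Poly_Mapping.single 0 c) = 0"
  using scale[of c 1] by (simp add: pm_scale_conv_mult)

lemma diff: "D (f - g) = D f - D g"
  using add[of "f - g" g] by simp

text \<open>A derivation is determined by its values on the variables; the commutation rules below
  are read off from this formula.\<close>

lemma chain_rule: "D f = (\<Sum>w\<in>UNIV. \<Sum>v\<in>UNIV. pm_scale (A v w) (pvar v * pdiff w f))"
proof -
  have "D f = (\<Sum>w\<in>UNIV. D (pvar w) * pdiff w f)"
  proof (induction f rule: mpoly_induct)
    case (pvar v f)
    have "(\<Sum>w\<in>UNIV. D (pvar w) * pdiff w (pvar v * f)) =
        (\<Sum>w\<in>UNIV. (if w = v then D (pvar w) * f else 0) + pvar v * (D (pvar w) * pdiff w f))"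
      unfolding pdiff_pvar_mult by (rule sum.cong) (auto simp: algebra_simps)
    then show ?case
      by (simp add: mult pvar sum.distrib sum_distrib_left)
  qed (auto simp: add pdiff_add algebra_simps sum.distrib)
  then show ?thesis
    by (simp add: pvar sum_distrib_right pm_scale_mult_left)
qed

text \<open>Variables are sent to linear forms, so \<open>D\<close> preserves degrees.\<close>

lemma deg_scale: "D (deg_scale r f) = deg_scale r (D f)"
  by (simp add: chain_rule deg_scale_sum deg_scale_pm_scale deg_scale_pvar_mult pdiff_deg_scale)

text \<open>The assumptions leave only summands \<open>pvar v * pdiff w f\<close> with both
  variables different from \<open>y\<close>, and these commute with taking coefficients.\<close>

lemma pcoeff:
  assumes "\<And>v. A v y = 0" "\<And>w. A y w = 0"
  shows "D (pcoeff y n f) = pcoeff y n (D f)"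
  unfolding chain_rule pcoeff_sum pcoeff_pm_scale
  using assms by (intro sum.cong) (metis pcoeff_pvar_mult pcoeff_pdiff pm.scale_zero_left)+

text \<open>The Fox derivatives obey the same commutation rule in \<open>fox_DL\<close>; this
  agreement makes \<pi> map constants to constants.\<close>

lemma pdiff: "pdiff u (D f) = D (pdiff u f) + (\<Sum>w\<in>UNIV. pm_scale (A u w) (pdiff w f))"
proof -
  have "pdiff u (pm_scale (A v w) (pvar v * pdiff w f)) = pm_scale (A v w) (pvar v * pdiff w (pdiff u f))
      + (if v = u then pm_scale (A u w) (pdiff w f) else 0)" for v w
    by (auto simp: pdiff_pm_scale pdiff_pvar_mult pdiff_commute[of u] pm.scale_right_distrib)
  then show ?thesis
    by (simp add: chain_rule pdiff_sum sum.distrib)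
qed

lemma constants_subalgebra: "poly_subalgebra (poly_constants D V)"
  using poly_subalgebra_polys_in[of V]
  by (auto simp: poly_subalgebra_def pm.subspace_def poly_constants_def add scale mult)

end

section \<open>Fox derivatives\<close>

text \<open>\<open>fox v\<close> is the \<open>v\<close>-th coordinate of the embedding of the free metabelian Lie algebra into an
  abelian wreath product, in which the generator \<open>v\<close> is mapped to \<open>(a\<^sub>v, pvar v)\<close>, where the \<open>a\<^sub>v\<close>
  are free generators of a module over the polynomial algebra.\<close>

primrec magma_lin :: "'v magma \<Rightarrow> ('v, 'k::field) mpoly" where
  "magma_lin (Gen w) = pvar w"
| "magma_lin (Br s t) = 0"

text \<open>The second equation is the bracket of the wreath product, in which the abelian quotient
  acts through \<open>magma_lin\<close>.\<close>

primrec magma_fox :: "'v \<Rightarrow> 'v magma \<Rightarrow> ('v, 'k::field) mpoly" where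
  "magma_fox v (Gen w) = (if w = v then 1 else 0)"
| "magma_fox v (Br s t) = magma_fox v s * magma_lin t - magma_fox v t * magma_lin s"

definition linear_ext :: "('a \<Rightarrow> ('v, 'k::field) mpoly) \<Rightarrow> ('a \<Rightarrow>\<^sub>0 'k) \<Rightarrow> ('v, 'k) mpoly" where
  "linear_ext h f = (\<Sum>t\<in>Poly_Mapping.keys f. pm_scale (Poly_Mapping.lookup f t) (h t))"

lemma linear_ext_add: "linear_ext h (f + g) = linear_ext h f + linear_ext h g"
  unfolding linear_ext_def by (rule setsum_keys_plus_distrib) (auto simp: pm.scale_left_distrib)

lemma linear_ext_zero [simp]: "linear_ext h 0 = 0"
  by (simp add: linear_ext_def)

lemma linear_ext_single: "linear_ext h (Poly_Mapping.single t c) = pm_scale c (h t)"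
  by (simp add: linear_ext_def)

lemma linear_ext_scale: "linear_ext h (pm_scale c f) = pm_scale c (linear_ext h f)"
  by (induction f rule: poly_mapping_single_induct)
    (auto simp: linear_ext_add linear_ext_single pm_scale_single pm.scale_right_distrib)

lemma linear_ext_diff: "linear_ext h (f - g) = linear_ext h f - linear_ext h g"
  using linear_ext_add[of h "f - g" g] by simp

lemma na_mult_zero [simp]: "na_mult 0 f = 0" "na_mult f 0 = 0"
  using na_mult_simps(1)[of 0 0 f] na_mult_simps(2)[of f 0 0] by simp_all

lemma na_mult_single:
  "na_mult (Poly_Mapping.single s a) (Poly_Mapping.single t b) = Poly_Mapping.single (Br s t) (a * b)"
  by (rule poly_mapping_eqI) (auto simp: lookup_na_mult lookup_single when_def split: magma.splits)

text \<open>With two auxiliary functions one bilinearity argument covers both the Fox derivatives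
  and, for zero functions, the linear part.\<close>

lemma linear_ext_na_mult:
  assumes "\<And>s t. h (Br s t) = h1 s * h2 t - h1 t * h2 s"
  shows "linear_ext h (na_mult f g) = linear_ext h1 f * linear_ext h2 g - linear_ext h1 g * linear_ext h2 f"
proof (induction f rule: poly_mapping_single_induct)
  case (single s a)
  show ?case
  proof (induction g rule: poly_mapping_single_induct)
    case (single t b)
    show ?case
      by (simp add: na_mult_single linear_ext_single assms pm_scale_mult_left pm_scale_mult_right
          pm.scale_right_diff_distrib mult.commute)
  qed (simp_all add: na_mult_simps linear_ext_add algebra_simps)
qed (simp_all add: na_mult_simps linear_ext_add algebra_simps)

lemma linear_ext_lin_na_mult: "linear_ext magma_lin (na_mult f g) = 0"
  using linear_ext_na_mult[of magma_lin "\<lambda>_. 0" "\<lambda>_. 0" f g] by (simp add: linear_ext_def)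

lemmas linear_ext_fox_na_mult = linear_ext_na_mult[where h = "magma_fox v" for v, OF magma_fox.simps(2)]

text \<open>Both equations are carried through the induction together, since the Fox derivative of a
  product contains the linear parts of its factors.\<close>

lemma linear_ext_lie_ideal:
  assumes "f \<in> lie_ideal"
  shows "linear_ext magma_lin f = 0 \<and> linear_ext (magma_fox v) f = 0"
  using assms
  by induction
    (auto simp: linear_ext_add linear_ext_scale linear_ext_fox_na_mult linear_ext_lin_na_mult,
      simp add: algebra_simps)

section \<open>Descent to the free Lie algebra and its metabelian quotient\<close>

lift_definition fl_lin :: "('v, 'k::field) free_lie \<Rightarrow> ('v, 'k) mpoly" is "linear_ext magma_lin"
  using linear_ext_lie_ideal by (force simp: lie_rel_def linear_ext_diff)

lift_definition fl_fox :: "'v \<Rightarrow> ('v, 'k::field) free_lie \<Rightarrow> ('v, 'k) mpoly"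
  is "\<lambda>v. linear_ext (magma_fox v)"
  using linear_ext_lie_ideal by (force simp: lie_rel_def linear_ext_diff)

lemma fl_lin_simps:
  "fl_lin (u + w) = fl_lin u + fl_lin w" "fl_lin (u - w) = fl_lin u - fl_lin w"
  "fl_lin (fl_scale c u) = pm_scale c (fl_lin u)"
  "fl_lin (fl_brac u w) = 0" "fl_lin (fl_gen v) = pvar v" "fl_lin 0 = 0"
  by (transfer; simp add: linear_ext_add linear_ext_diff linear_ext_scale linear_ext_lin_na_mult
      linear_ext_single)+

lemma fl_fox_simps:
  "fl_fox v (u + w) = fl_fox v u + fl_fox v w" "fl_fox v (u - w) = fl_fox v u - fl_fox v w"
  "fl_fox v (fl_scale c u) = pm_scale c (fl_fox v u)"
  "fl_fox v (fl_brac u w) = fl_fox v u * fl_lin w - fl_fox v w * fl_lin u"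
  "fl_fox v (fl_gen v') = (if v' = v then 1 else 0)" "fl_fox v 0 = 0"
  by (transfer; simp add: linear_ext_add linear_ext_diff linear_ext_scale linear_ext_fox_na_mult
      linear_ext_single)+

lemma fl_lin_derived: "u \<in> fl.derived S \<Longrightarrow> fl_lin u = 0"
  unfolding fl.derived_def by (induction rule: fl.span_induct_alt) (auto simp: fl_lin_simps)

text \<open>A bracket of two elements without linear part has zero Fox derivatives, so these descend
  to the metabelian quotient.\<close>

lemma fl_derived_derived:
  assumes "u \<in> fl.derived (fl.derived S)"
  shows "fl_lin u = 0 \<and> fl_fox v u = 0"
  using assms unfolding fl.derived_def[of "fl.derived S"]
  by (induction rule: fl.span_induct_alt) (auto simp: fl_lin_simps fl_fox_simps fl_lin_derived)

lift_definition fm_lin :: "('v, 'k::field) free_metab \<Rightarrow> ('v, 'k) mpoly" is fl_lin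
  using fl_derived_derived by (force simp: metab_rel_def fl_lin_simps)

lift_definition fox :: "'v \<Rightarrow> ('v, 'k::field) free_metab \<Rightarrow> ('v, 'k) mpoly" is fl_fox
  using fl_derived_derived by (force simp: metab_rel_def fl_fox_simps)

lemma fm_lin_simps [simp]:
  "fm_lin (u + w) = fm_lin u + fm_lin w" "fm_lin (u - w) = fm_lin u - fm_lin w"
  "fm_lin (fm_scale c u) = pm_scale c (fm_lin u)"
  "fm_lin (fm_brac u w) = 0" "fm_lin (fm_gen v) = pvar v" "fm_lin 0 = 0"
  by (transfer; simp add: fl_lin_simps)+

lemma fox_simps [simp]:
  "fox v (u + w) = fox v u + fox v w" "fox v (u - w) = fox v u - fox v w"
  "fox v (fm_scale c u) = pm_scale c (fox v u)"
  "fox v (fm_brac u w) = fox v u * fm_lin w - fox v w * fm_lin u"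
  "fox v (fm_gen v') = (if v' = v then 1 else 0)" "fox v 0 = 0"
  by (transfer; simp add: fl_fox_simps)+

lemma fox_sum: "fox v (\<Sum>i\<in>I. h i) = (\<Sum>i\<in>I. fox v (h i))"
  by (induction I rule: infinite_finite_induct) auto

lemma fm_lin_sum: "fm_lin (\<Sum>i\<in>I. h i) = (\<Sum>i\<in>I. fm_lin (h i))"
  by (induction I rule: infinite_finite_induct) auto

lemma fm_induct [case_names gen add scale brac]:
  assumes "\<And>v. P (fm_gen v)" "\<And>u w. P u \<Longrightarrow> P w \<Longrightarrow> P (u + w)"
    "\<And>c u. P u \<Longrightarrow> P (fm_scale c u)" "\<And>u w. P u \<Longrightarrow> P w \<Longrightarrow> P (fm_brac u w)"
  shows "P (u :: ('v, 'k::field) free_metab)"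
proof -
  \<comment> \<open>Zero is the zero multiple of a generator, which exists since types are
    nonempty.\<close>
  have "P 0" using assms(3)[OF assms(1), of 0] by simp
  then have "fm.lie_subalgebra (Collect P)"
    using assms(2-4) by (auto simp: fm.lie_subalgebra_def fm.subspace_def)
  then have "fm.lie_generated (range fm_gen) \<subseteq> Collect P"
    unfolding fm.lie_generated_def using assms(1) by (intro hull_minimal) auto
  then show ?thesis using fm_generated_UNIV by blast
qed

text \<open>The analogue of Fox's fundamental formula. On the derived algebra the right-hand side
  vanishes, so the Fox derivatives form a Koszul cycle.\<close>

lemma fox_fundamental: "(\<Sum>v\<in>UNIV. pvar v * fox v u) = fm_lin (u :: ('v::finite, 'k::field) free_metab)"
proof (induction u rule: fm_induct)
  case (gen v)
  show ?case by (simp add: if_distrib[of "(*) _"] cong: if_cong)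
next
  case (brac u w)
  have "(\<Sum>v\<in>UNIV. pvar v * fox v (fm_brac u w)) =
      (\<Sum>v\<in>UNIV. pvar v * fox v u) * fm_lin w - (\<Sum>v\<in>UNIV. pvar v * fox v w) * fm_lin u"
    by (simp add: algebra_simps sum_subtractf sum_distrib_left)
  then show ?case using brac by simp
qed (simp_all add: distrib_left sum.distrib pm.scale_sum_right[symmetric] pm_scale_mult_right)

section \<open>The derived algebra as a module\<close>

text \<open>Both factors have representatives in the derived algebra of the free Lie algebra, and
  the bracket of these lies in the second derived algebra.\<close>

lemma fm_metabelian:
  assumes "u \<in> fm.derived UNIV" "w \<in> fm.derived UNIV"
  shows "fm_brac u w = 0"
proof -
  have rep: "\<exists>a\<in>fl.derived UNIV. u = abs_free_metab a" if "u \<in> fm.derived UNIV"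
    for u :: "('a, 'b) free_metab"
    using that unfolding fm.derived_def
  proof (induction rule: fm.span_induct_alt)
    case base
    then show ?case
      using fl.subspace_0[OF fl.derived_subspace] by (auto simp: zero_free_metab_def)
  next
    case (step c x y)
    then obtain p q where x: "x = fm_brac p q" by blast
    have "\<exists>p'. p = abs_free_metab p'" for p :: "('a, 'b) free_metab"
      by (induction p rule: free_metab.abs_induct) blast
    then obtain p' q' where "p = abs_free_metab p'" "q = abs_free_metab q'"
      by blast
    moreover from step obtain b where b: "b \<in> fl.derived UNIV" "y = abs_free_metab b" by blast
    ultimately have "fm_scale c x + y = abs_free_metab (fl_scale c (fl_brac p' q') + b)"
      by (simp add: x fm_brac.abs_eq fm_scale.abs_eq plus_free_metab.abs_eq)
    moreover have "fl_scale c (fl_brac p' q') + b \<in> fl.derived UNIV"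
      using b(1) by (intro fl.subspace_add fl.subspace_scale fl.derived_subspace)
        (auto simp: fl.derived_def intro: fl.span_base)
    ultimately show ?case by blast
  qed
  obtain a b where ab: "a \<in> fl.derived UNIV" "u = abs_free_metab a"
    "b \<in> fl.derived UNIV" "w = abs_free_metab b"
    using rep assms by metis
  then have "fl_brac a b \<in> fl.derived (fl.derived UNIV)"
    unfolding fl.derived_def[of "fl.derived UNIV"] by (intro fl.span_base) auto
  then have "metab_rel (fl_brac a b) 0"
    by (simp add: metab_rel_def)
  then show ?thesis
    by (simp add: ab fm_brac.abs_eq zero_free_metab_def free_metab.abs_eq_iff)
qed

lemma fm_derived_brac [simp]: "fm_brac u w \<in> fm.derived UNIV"
  unfolding fm.derived_def by (intro fm.span_base) auto

lemma fm_lin_derived: "u \<in> fm.derived S \<Longrightarrow> fm_lin u = 0"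
  unfolding fm.derived_def by (induction rule: fm.span_induct_alt) auto

lemma fm_derived_UNIV: "fm_derived UNIV = fm.derived UNIV"
  by (simp add: fm_derived_def fm_generated_UNIV)

lemma fm_brac_uminus_left: "fm_brac (- u) w = - fm_brac u w"
  using fm.brac_diff_left[of 0 u w] by simp

text \<open>In the Jacobi identity the term with the bracket of \<open>a\<close> and
  \<open>b\<close> vanishes, because \<open>u\<close> lies in the derived algebra as well.\<close>

lemma ad_commute:
  assumes "u \<in> fm.derived UNIV"
  shows "fm_brac (fm_brac u a) b = fm_brac (fm_brac u b) a"
proof -
  have "fm_brac (fm_brac u a) b + fm_brac (fm_brac a b) u + fm_brac (fm_brac b u) a = 0"
    by (rule fm.jacobi)
  moreover have "fm_brac (fm_brac a b) u = 0"
    using assms by (intro fm_metabelian) auto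
  moreover have "fm_brac (fm_brac b u) a = - fm_brac (fm_brac u b) a"
    by (simp add: fm.brac_antisym[of b u] fm_brac_uminus_left)
  ultimately show ?thesis by simp
qed

locale variable_order =
  fixes vs :: "'v::finite list"
  assumes distinct: "distinct vs" and set: "set vs = UNIV"
begin

lemma ad_power_derived:
  "u \<in> fm.derived UNIV \<Longrightarrow> ((\<lambda>w. fm_brac w (fm_gen v)) ^^ n) u \<in> fm.derived UNIV"
  by (cases n) auto

lemma ad_power_commute:
  assumes "u \<in> fm.derived UNIV"
  shows "((\<lambda>w. fm_brac w (fm_gen v)) ^^ n) (fm_brac u a) = fm_brac (((\<lambda>w. fm_brac w (fm_gen v)) ^^ n) u) a"
  by (induction n) (simp_all add: ad_commute[OF ad_power_derived[OF assms], where a = a])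

lemma ad_fold_derived:
  "u \<in> fm.derived UNIV \<Longrightarrow> ad_monomial us u m \<in> fm.derived UNIV"
  unfolding ad_monomial_def by (induction us arbitrary: u) (auto simp: ad_power_derived)

lemma ad_fold_commute:
  "u \<in> fm.derived UNIV \<Longrightarrow> ad_monomial us (fm_brac u a) m = fm_brac (ad_monomial us u m) a"
  unfolding ad_monomial_def
  by (induction us arbitrary: u) (auto simp: ad_power_derived ad_power_commute)

text \<open>The extra bracket arises at the place of \<open>v\<close> in the list and is then moved
  past the later operators. Arbitrary distinct lists make the induction possible.\<close>

lemma ad_fold_add_single:
  assumes "u \<in> fm.derived UNIV" "distinct us"
  shows "ad_monomial us u (m + Poly_Mapping.single v 1) =
    (if v \<in> set us then fm_brac (ad_monomial us u m) (fm_gen v) else ad_monomial us u m)"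
  using assms
proof (induction us arbitrary: u)
  case (Cons a us)
  let ?A = "(\<lambda>w. fm_brac w (fm_gen a)) ^^ Poly_Mapping.lookup m a"
  have Cons_eq: "ad_monomial (a # us) u m' =
      ad_monomial us (((\<lambda>w. fm_brac w (fm_gen a)) ^^ Poly_Mapping.lookup m' a) u) m'" for m'
    by (simp add: ad_monomial_def)
  have A: "?A u \<in> fm.derived UNIV" using Cons.prems by (intro ad_power_derived)
  show ?case
  proof (cases "v = a")
    case True
    then have "ad_monomial (a # us) u (m + Poly_Mapping.single v 1) =
        ad_monomial us (fm_brac (?A u) (fm_gen a)) (m + Poly_Mapping.single v 1)"
      by (simp add: Cons_eq lookup_add)
    also have "\<dots> = fm_brac (ad_monomial us (?A u) m) (fm_gen a)"
      using Cons.IH[OF A] Cons.prems True by (simp add: ad_fold_commute[OF A])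
    finally show ?thesis using True by (simp add: Cons_eq)
  next
    case False
    then show ?thesis using Cons.IH[OF A] Cons.prems by (simp add: Cons_eq lookup_add lookup_single)
  qed
qed (simp add: ad_monomial_def)

lemma ad_monomial_add_single:
  "u \<in> fm.derived UNIV \<Longrightarrow>
    ad_monomial vs u (m + Poly_Mapping.single v 1) = fm_brac (ad_monomial vs u m) (fm_gen v)"
  using ad_fold_add_single[OF _ distinct] set by simp

lemma ad_monomial_zero [simp]: "ad_monomial us u 0 = u"
  unfolding ad_monomial_def by (induction us) auto

section \<open>The action of polynomials on the derived algebra\<close>

abbreviation act :: "('v, 'k::field) free_metab \<Rightarrow> ('v, 'k) mpoly \<Rightarrow> ('v, 'k) free_metab"
    (infixl \<open>\<star>\<close> 70) where
  "u \<star> f \<equiv> fm_act vs u f"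

lemma act_add: "u \<star> (f + g) = u \<star> f + u \<star> g"
  unfolding fm_act_def by (rule setsum_keys_plus_distrib) (auto simp: fm.scale_left_distrib)

lemma act_zero [simp]: "u \<star> 0 = 0"
  by (simp add: fm_act_def)

lemma act_single: "u \<star> Poly_Mapping.single m c = fm_scale c (ad_monomial vs u m)"
  by (simp add: fm_act_def)

lemma act_const: "u \<star> Poly_Mapping.single 0 c = fm_scale c u"
  by (simp add: act_single)

lemma act_uminus: "u \<star> (- f) = - (u \<star> f)"
  using act_add[of u f "- f"] by (simp add: eq_neg_iff_add_eq_0 add.commute)

lemma act_sum: "u \<star> (\<Sum>i\<in>I. h i) = (\<Sum>i\<in>I. u \<star> h i)"
  by (induction I rule: infinite_finite_induct) (auto simp: act_add)

lemma act_derived: "u \<in> fm.derived UNIV \<Longrightarrow> u \<star> f \<in> fm.derived UNIV"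
  unfolding fm_act_def
  by (intro fm.subspace_sum fm.subspace_scale fm.derived_subspace ad_fold_derived)

lemma act_pvar_mult: "u \<in> fm.derived UNIV \<Longrightarrow> u \<star> (pvar v * f) = fm_brac (u \<star> f) (fm_gen v)"
proof (induction f rule: poly_mapping_single_induct)
  case (single m c)
  then show ?case
    by (simp only: pvar_mult_single act_single ad_monomial_add_single fm.brac_scale_left)
qed (auto simp: distrib_left act_add fm.brac_add_left)

lemma act_brac: "u \<in> fm.derived UNIV \<Longrightarrow> fm_brac u (fm_gen v) \<star> f = fm_brac (u \<star> f) (fm_gen v)"
  by (induction f rule: poly_mapping_single_induct)
    (auto simp: act_single act_add fm.brac_add_left ad_fold_commute fm.brac_scale_left)

lemma act_add_left:
  assumes "u \<in> fm.derived UNIV" "w \<in> fm.derived UNIV"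
  shows "(u + w) \<star> f = u \<star> f + w \<star> f"
proof (induction f rule: mpoly_induct)
  case (pvar v f)
  then show ?case
    using assms fm.subspace_add[OF fm.derived_subspace assms]
    by (simp add: act_pvar_mult fm.brac_add_left)
qed (simp_all add: act_const act_add fm.scale_right_distrib)

lemma act_zero_left [simp]: "0 \<star> f = 0"
  using act_add_left[of 0 0 f] by (simp add: fm.subspace_0 fm.derived_subspace)

lemma act_uminus_left: "u \<in> fm.derived UNIV \<Longrightarrow> (- u) \<star> f = - (u \<star> f)"
  using act_add_left[of "- u" u f]
  by (simp add: fm.subspace_neg fm.derived_subspace eq_neg_iff_add_eq_0)

text \<open>Linear parts vanish on the derived algebra, so a bracket with a generator just
  multiplies each Fox derivative by that variable.\<close>

lemma fox_act:
  assumes "u \<in> fm.derived UNIV"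
  shows "fox v (u \<star> f) = fox v u * f"
proof (induction f rule: mpoly_induct)
  case (pvar w f)
  then show ?case
    using fm_lin_derived[OF act_derived[OF assms]] by (simp add: act_pvar_mult[OF assms])
qed (simp_all add: act_const act_add algebra_simps pm_scale_conv_mult)

section \<open>Injectivity of the Fox derivatives\<close>

abbreviation comm :: "'v \<Rightarrow> 'v \<Rightarrow> ('v, 'k::field) free_metab" where
  "comm v w \<equiv> fm_brac (fm_gen v) (fm_gen w)"

text \<open>Let \<open>L\<close> be the span of the generators. The span \<open>G\<close> on the
  right is closed under brackets with \<open>L\<close>, and the whole algebra is
  \<open>L + G\<close>; hence every bracket lies in \<open>G\<close>.\<close>

lemma derived_eq_span: "fm.derived UNIV = fm.span {comm v w \<star> (f :: ('v, 'k::field) mpoly) | v w f. True}"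
proof -
  define G where "G = fm.span {comm v w \<star> (f :: ('v, 'k) mpoly) | v w f. True}"
  have G_span [simp]: "0 \<in> G" "\<And>a b. a \<in> G \<Longrightarrow> b \<in> G \<Longrightarrow> a + b \<in> G"
    "\<And>c a. a \<in> G \<Longrightarrow> fm_scale c a \<in> G" "\<And>a b. a \<in> G \<Longrightarrow> b \<in> G \<Longrightarrow> a - b \<in> G"
    by (simp_all add: G_def fm.span_zero fm.span_add fm.span_scale fm.span_diff)
  have G_base: "comm v w \<star> f \<in> G" for v w f
    unfolding G_def by (intro fm.span_base) blast
  have gen_left: "fm_brac a (fm_gen z) \<in> G" if "a \<in> G" for a z
    using that unfolding G_def
  proof (induction rule: fm.span_induct_alt)
    case (step c a b)
    then obtain v w f where "a = comm v w \<star> f" by blast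
    then have "fm_brac a (fm_gen z) = comm v w \<star> (pvar z * f)"
      by (simp add: act_pvar_mult)
    then have "fm_brac a (fm_gen z) \<in> G" by (simp add: G_base)
    then show ?case using step.IH
      unfolding G_def[symmetric] by (simp add: fm.brac_add_left fm.brac_scale_left)
  qed (simp add: fm.span_zero)
  have sub: "G \<subseteq> fm.derived UNIV"
    unfolding G_def by (intro fm.span_minimal fm.derived_subspace) (auto intro: act_derived)
  have comm: "comm v w \<in> G" for v w
    using act_const[of "comm v w" "1 :: 'k"] G_base[of v w 1] by simp
  define L where "L = fm.span (range (fm_gen :: 'v \<Rightarrow> ('v, 'k) free_metab))"
  have L_left: "fm_brac a b \<in> G" if "a \<in> G" "b \<in> L" for a b
    using that(2) unfolding L_def
    by (induction rule: fm.span_induct_alt)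
      (auto simp: fm.brac_add_right fm.brac_scale_right gen_left[OF that(1)])
  have L_gen: "fm_brac a (fm_gen w) \<in> G" if "a \<in> L" for a w
    using that unfolding L_def
    by (induction rule: fm.span_induct_alt)
      (auto simp: fm.brac_add_left fm.brac_scale_left comm)
  have L_L: "fm_brac a b \<in> G" if "a \<in> L" "b \<in> L" for a b
    using that(2) unfolding L_def
    by (induction rule: fm.span_induct_alt)
      (auto simp: fm.brac_add_right fm.brac_scale_right L_gen[OF that(1)])
  have brac_mem: "fm_brac (a + b) (a' + b') \<in> G"
    if "a \<in> L" "b \<in> G" "a' \<in> L" "b' \<in> G" for a b a' b'
  proof -
    \<comment> \<open>Of the four brackets this one vanishes by metabelianity, and the other three
      have a factor in \<open>L\<close>.\<close>
    have "fm_brac b b' = 0" using that sub by (intro fm_metabelian) auto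
    moreover have "fm_brac a b' = - fm_brac b' a" by (rule fm.brac_antisym)
    ultimately show ?thesis
      using L_L[OF that(1,3)] L_left[OF that(2,3)] L_left[OF that(4,1)]
      by (auto simp: fm.brac_add_left fm.brac_add_right)
  qed
  have decomp: "\<exists>a\<in>L. \<exists>b\<in>G. u = a + b" for u
  proof (induction u rule: fm_induct)
    case (gen v)
    then show ?case
      by (intro bexI[of _ "fm_gen v"] bexI[of _ 0]) (auto simp: L_def intro: fm.span_base)
  next
    case (add u w)
    then obtain a b a' b' where "a \<in> L" "b \<in> G" "a' \<in> L" "b' \<in> G"
      "u = a + b" "w = a' + b'" by blast
    then show ?case
      by (intro bexI[of _ "a + a'"] bexI[of _ "b + b'"]) (auto simp: L_def fm.span_add)
  next
    case (scale c u)
    then obtain a b where "a \<in> L" "b \<in> G" "u = a + b" by blast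
    then show ?case
      by (intro bexI[of _ "fm_scale c a"] bexI[of _ "fm_scale c b"])
        (auto simp: L_def fm.span_scale fm.scale_right_distrib)
  next
    case (brac u w)
    then obtain a b a' b' where "a \<in> L" "b \<in> G" "a' \<in> L" "b' \<in> G"
      "u = a + b" "w = a' + b'" by blast
    then show ?case
      using brac_mem by (intro bexI[of _ 0] bexI[of _ "fm_brac u w"]) (auto simp: L_def fm.span_zero)
  qed
  have "fm.derived UNIV \<subseteq> G"
    unfolding fm.derived_def
  proof (intro fm.span_minimal subsetI)
    fix z assume "z \<in> {fm_brac u v | u v. u \<in> (UNIV :: ('v, 'k) free_metab set) \<and> v \<in> UNIV}"
    then obtain u v where "z = fm_brac u v" by blast
    then show "z \<in> G" using brac_mem decomp by metis
  qed (simp add: fm.subspace_def)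
  with sub show ?thesis unfolding G_def by blast
qed

text \<open>The contracting homotopy of the Koszul complex that comes from Euler's identity. The weight
  \<open>1 / Suc n\<close> turns it into a two-sided inverse of the Fox derivatives, so the derived algebra
  is identified with the tuples \<open>t\<close> such that the sum of all \<open>pvar v * t v\<close> vanishes.\<close>

definition unfox :: "('v \<Rightarrow> ('v, 'k::field) mpoly) \<Rightarrow> ('v, 'k) free_metab" where
  "unfox t = (\<Sum>v\<in>UNIV. \<Sum>w\<in>UNIV.
     comm v w \<star> pdiff w (deg_scale (\<lambda>n. 1 / of_nat (Suc n)) (t v)))"

lemma unfox_add: "unfox (\<lambda>v. t v + t' v) = unfox t + unfox t'"
  by (simp add: unfox_def deg_scale_add pdiff_add act_add sum.distrib)

lemma fm_scale_act: "fm_scale c (u \<star> f) = u \<star> pm_scale c f"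
  by (induction f rule: poly_mapping_single_induct)
    (auto simp: act_single act_add pm_scale_single fm.scale_right_distrib pm.scale_right_distrib)

lemma unfox_scale: "unfox (\<lambda>v. pm_scale c (t v)) = fm_scale c (unfox t)"
  by (simp add: unfox_def deg_scale_pm_scale pdiff_pm_scale fm_scale_act fm.scale_sum_right)

lemma unfox_derived: "unfox t \<in> fm.derived UNIV"
  unfolding unfox_def by (intro fm.subspace_sum fm.derived_subspace act_derived) auto

text \<open>The product rule produces two copies of \<open>comm v w \<star> g\<close>, and the
  Jacobi identity adds the Euler operator of \<open>g\<close>. On degree \<open>n\<close> this is
  the factor \<open>n + 2\<close>, which cancels the weight in \<open>g\<close>.\<close>

lemma unfox_comm_act: 
  fixes f :: "('v, 'k::field_char_0) mpoly"
  shows "unfox (\<lambda>z. fox z (comm v w \<star> f)) = comm v w \<star> f"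
proof -
  \<comment> \<open>The weight of \<open>unfox\<close> is shifted once more, since the Fox
    derivatives of the commutator contribute a variable.\<close>
  define g :: "('v, 'k) mpoly" where "g = deg_scale (\<lambda>n. 1 / of_nat (Suc (Suc n))) f"
  have D: "comm a b \<in> fm.derived UNIV" for a b :: 'v by simp
  have half: "(\<Sum>z\<in>UNIV. comm a z \<star> pdiff z (pvar b * g)) =
      comm a b \<star> g + (\<Sum>z\<in>UNIV. fm_brac (comm a z) (fm_gen b) \<star> pdiff z g)" for a b
  proof -
    have "comm a z \<star> pdiff z (pvar b * g) =
        (if z = b then comm a b \<star> g else 0) + fm_brac (comm a z) (fm_gen b) \<star> pdiff z g" for z
      by (auto simp: pdiff_pvar_mult act_add act_pvar_mult[OF D] act_brac[OF D])
    then show ?thesis by (simp add: sum.distrib)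
  qed
  have jac: "fm_brac (comm v z) (fm_gen w) \<star> h = comm v w \<star> (pvar z * h) + fm_brac (comm w z) (fm_gen v) \<star> h"
    for z and h :: "('v, 'k) mpoly"
  proof -
    have "fm_brac (comm v w) (fm_gen z :: ('v, 'k) free_metab) + fm_brac (comm w z) (fm_gen v) + fm_brac (comm z v) (fm_gen w) = 0"
      by (rule fm.jacobi)
    moreover have "fm_brac (comm z v) (fm_gen w :: ('v, 'k) free_metab) = - fm_brac (comm v z) (fm_gen w)"
      by (simp add: fm.brac_antisym[of "fm_gen z" "fm_gen v"] fm_brac_uminus_left)
    ultimately have "fm_brac (comm v w) (fm_gen z :: ('v, 'k) free_metab) + fm_brac (comm w z) (fm_gen v)
        - fm_brac (comm v z) (fm_gen w) = 0"
      by simp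
    then have "fm_brac (comm v z) (fm_gen w :: ('v, 'k) free_metab) =
        fm_brac (comm v w) (fm_gen z) + fm_brac (comm w z) (fm_gen v)"
      by (simp only: right_minus_eq)
    then show ?thesis by (simp add: act_add_left act_brac[OF D] act_pvar_mult[OF D])
  qed
  have "deg_scale (\<lambda>n. 1 / of_nat (Suc n)) (fox z (comm v w \<star> f)) =
      (if z = v then pvar w * g else 0) - (if z = w then pvar v * g else 0)" for z
    by (simp add: fox_act[OF D] g_def deg_scale_pvar_mult deg_scale_uminus left_diff_distrib
        minus_mult_left[symmetric])
  then have "unfox (\<lambda>z. fox z (comm v w \<star> f)) = (\<Sum>a\<in>UNIV. \<Sum>z\<in>UNIV.
      comm a z \<star> pdiff z ((if a = v then pvar w * g else 0) - (if a = w then pvar v * g else 0)))"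
    by (simp add: unfox_def)
  also have "\<dots> = (\<Sum>a\<in>UNIV. (if a = v then (\<Sum>z\<in>UNIV. comm a z \<star> pdiff z (pvar w * g)) else 0)
      + (if a = w then - (\<Sum>z\<in>UNIV. comm a z \<star> pdiff z (pvar v * g)) else 0))"
    by (rule sum.cong) (auto simp: pdiff_uminus act_uminus sum_negf fm.brac_self)
  also have "\<dots> = (\<Sum>z\<in>UNIV. comm v z \<star> pdiff z (pvar w * g)) - (\<Sum>z\<in>UNIV. comm w z \<star> pdiff z (pvar v * g))"
    by (simp add: sum.distrib)
  \<comment> \<open>By \<open>jac\<close> the two sums of triple brackets cancel up to the terms
    with \<open>pvar z\<close>.\<close>
  also have "\<dots> = comm v w \<star> g - comm w v \<star> g + (\<Sum>z\<in>UNIV. comm v w \<star> (pvar z * pdiff z g))"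
    by (simp add: half jac sum.distrib)
  also have "(\<Sum>z\<in>UNIV. comm v w \<star> (pvar z * pdiff z g)) = comm v w \<star> deg_scale of_nat g"
    by (simp add: act_sum[symmetric] euler_identity)
  also have "comm w v \<star> g = - (comm v w \<star> g)"
    by (simp add: fm.brac_antisym[of "fm_gen w" "fm_gen v"] act_uminus_left[OF D])
  also have "comm v w \<star> g - - (comm v w \<star> g) + comm v w \<star> deg_scale of_nat g =
      comm v w \<star> (g + g + deg_scale of_nat g)"
    by (simp only: act_add diff_minus_eq_add)
  also have "g + g + deg_scale of_nat g = f"
  proof (rule poly_mapping_eqI)
    fix m :: "'v \<Rightarrow>\<^sub>0 nat"
    define r :: 'k where "r = 1 / of_nat (Suc (Suc (mdeg m)))"
    have r: "(2 + of_nat (mdeg m)) * r = 1"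
      using of_nat_neq_0[of "Suc (mdeg m)", where ?'a = 'k] by (simp add: r_def add.assoc[symmetric])
    have "Poly_Mapping.lookup g m = r * Poly_Mapping.lookup f m"
      by (simp only: g_def r_def lookup_deg_scale)
    then have "Poly_Mapping.lookup (g + g + deg_scale of_nat g) m =
        ((2 + of_nat (mdeg m)) * r) * Poly_Mapping.lookup f m"
      by (simp only: lookup_add lookup_deg_scale) (simp add: algebra_simps)
    then show "Poly_Mapping.lookup (g + g + deg_scale of_nat g) m = Poly_Mapping.lookup f m"
      by (simp only: r mult_1)
  qed
  finally show ?thesis .
qed

lemma unfox_fox:
  fixes u :: "('v, 'k::field_char_0) free_metab"
  assumes "u \<in> fm.derived UNIV"
  shows "unfox (\<lambda>v. fox v u) = u"
  using assms unfolding derived_eq_span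
proof (induction rule: fm.span_induct_alt)
  case base
  then show ?case by (simp add: unfox_def)
next
  case (step c x y)
  then show ?case using unfox_comm_act by (auto simp: unfox_add unfox_scale)
qed

text \<open>\<open>unfox\<close> recovers an element from its Fox derivatives. Identities in the
  derived algebra can now be checked on polynomials.\<close>

lemma fox_inject:
  fixes u w :: "('v, 'k::field_char_0) free_metab"
  assumes "u \<in> fm.derived UNIV" "w \<in> fm.derived UNIV" "\<And>v. fox v u = fox v w"
  shows "u = w"
proof -
  have "(\<lambda>v. fox v u) = (\<lambda>v. fox v w)" by (rule ext) (rule assms(3))
  then have "unfox (\<lambda>v. fox v u) = unfox (\<lambda>v. fox v w)" by (rule arg_cong)
  then show ?thesis by (simp only: unfox_fox[OF assms(1)] unfox_fox[OF assms(2)])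
qed

text \<open>Differentiating the weighted cycle condition by \<open>z\<close> evaluates one half of
  the double sum, and Euler's identity the other. Together they give the factor \<open>n + 1\<close>
  on degree \<open>n\<close>, the inverse of the weight.\<close>

lemma fox_unfox:
  fixes t :: "'v \<Rightarrow> ('v, 'k::field_char_0) mpoly"
  assumes "(\<Sum>v\<in>UNIV. pvar v * t v) = 0"
  shows "fox z (unfox t) = t z"
proof -
  define r :: "nat \<Rightarrow> 'k" where "r n = 1 / of_nat (Suc n)" for n
  \<comment> \<open>Products with a variable have no term of degree 0, so the truncated value of
    \<open>n - 1\<close> at 0 does not enter.\<close>
  have "(\<Sum>v\<in>UNIV. pvar v * deg_scale r (t v)) = deg_scale (\<lambda>n. r (n - 1)) (\<Sum>v\<in>UNIV. pvar v * t v)"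
    by (simp add: deg_scale_sum deg_scale_pvar_mult)
  then have "pdiff z (\<Sum>v\<in>UNIV. pvar v * deg_scale r (t v)) = 0"
    using assms by simp
  moreover have "pdiff z (\<Sum>v\<in>UNIV. pvar v * deg_scale r (t v)) =
      (\<Sum>v\<in>UNIV. (if v = z then deg_scale r (t v) else 0) + pvar v * pdiff z (deg_scale r (t v)))"
    by (simp add: pdiff_sum pdiff_pvar_mult)
  ultimately have 1: "(\<Sum>v\<in>UNIV. pvar v * pdiff z (deg_scale r (t v))) = - deg_scale r (t z)"
    by (simp add: sum.distrib eq_neg_iff_add_eq_0 add.commute)
  have D: "comm a b \<in> fm.derived UNIV" for a b :: 'v by simp
  have "fox z (unfox t) = (\<Sum>v\<in>UNIV. \<Sum>w\<in>UNIV.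
      (if v = z then pvar w * pdiff w (deg_scale r (t v)) else 0)
      - (if w = z then pvar v * pdiff w (deg_scale r (t v)) else 0))"
    unfolding unfox_def fox_sum r_def[symmetric]
    by (intro sum.cong refl) (simp add: fox_act[OF D] left_diff_distrib)
  also have "\<dots> = (\<Sum>v\<in>UNIV. (if v = z then (\<Sum>w\<in>UNIV. pvar w * pdiff w (deg_scale r (t v))) else 0)
      - pvar v * pdiff z (deg_scale r (t v)))"
    by (rule sum.cong) (auto simp: sum_subtractf)
  also have "\<dots> = deg_scale of_nat (deg_scale r (t z)) + deg_scale r (t z)"
    by (simp add: sum_subtractf 1 euler_identity)
  also have "\<dots> = t z"
  proof (rule poly_mapping_eqI)
    fix m :: "'v \<Rightarrow>\<^sub>0 nat"
    have "(1 :: 'k) + of_nat (mdeg m) \<noteq> 0"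
      using of_nat_neq_0[of "mdeg m", where ?'a = 'k] by simp
    then have "r (mdeg m) * (1 + of_nat (mdeg m)) = 1"
      by (simp add: r_def)
    moreover have "Poly_Mapping.lookup (deg_scale of_nat (deg_scale r (t z)) + deg_scale r (t z)) m =
        (r (mdeg m) * (1 + of_nat (mdeg m))) * Poly_Mapping.lookup (t z) m"
      by (simp add: lookup_add lookup_deg_scale algebra_simps)
    ultimately show "Poly_Mapping.lookup (deg_scale of_nat (deg_scale r (t z)) + deg_scale r (t z)) m =
        Poly_Mapping.lookup (t z) m"
      by simp
  qed
  finally show ?thesis .
qed

lemma act_mult:
  fixes u :: "('v, 'k::field_char_0) free_metab"
  assumes "u \<in> fm.derived UNIV"
  shows "u \<star> (f * g) = (u \<star> f) \<star> g"
  using assms by (intro fox_inject) (simp_all add: act_derived fox_act mult.assoc)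

lemma act_sum_left:
  assumes "\<And>i. i \<in> I \<Longrightarrow> h i \<in> fm.derived UNIV"
  shows "(\<Sum>i\<in>I. h i) \<star> (f :: ('v, 'k::field_char_0) mpoly) = (\<Sum>i\<in>I. h i \<star> f)"
  using assms
  by (intro fox_inject act_derived fm.subspace_sum fm.derived_subspace)
    (simp_all add: act_derived fox_act fox_sum sum_distrib_right fm.subspace_sum fm.derived_subspace)

section \<open>The map \<open>\<pi>\<close>\<close>

lemma pi_map_add: "pi_map vs y (f + g) = pi_map vs y f + pi_map vs y g"
  unfolding pi_map_def by (rule setsum_keys_plus_distrib) (auto simp: fm.scale_left_distrib)

text \<open>The multiplicities in the definition are the exponents produced by differentiation, so
  \<pi> pairs the commutators with \<open>y\<close> against the gradient.\<close>

lemma pi_map_eq: "pi_map vs y f = (\<Sum>w\<in>UNIV. comm y w \<star> pdiff w f)"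
proof (induction f rule: poly_mapping_single_induct)
  case zero
  then show ?case by (simp add: pi_map_def)
next
  case (single m c)
  let ?e = "\<lambda>v. comm y v \<star> Poly_Mapping.single (m - Poly_Mapping.single v 1) (1 :: 'a)"
  have "pi_map vs y (Poly_Mapping.single m c) =
      fm_scale c (\<Sum>v\<in>Poly_Mapping.keys m. fm_scale (of_nat (Poly_Mapping.lookup m v)) (?e v))"
    by (simp add: pi_map_def)
  also have "(\<Sum>v\<in>Poly_Mapping.keys m. fm_scale (of_nat (Poly_Mapping.lookup m v)) (?e v)) =
      (\<Sum>v\<in>UNIV. fm_scale (of_nat (Poly_Mapping.lookup m v)) (?e v))"
    by (rule sum.mono_neutral_left) (auto simp: in_keys_iff)
  also have "fm_scale c \<dots> = (\<Sum>w\<in>UNIV. comm y w \<star> pdiff w (Poly_Mapping.single m c))"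
    by (simp add: fm.scale_sum_right pdiff_single act_single mult.commute)
  finally show ?case .
next
  case (add f g)
  then show ?case by (simp add: pi_map_add pdiff_add act_add sum.distrib)
qed

lemma pi_map_derived: "pi_map vs y f \<in> fm.derived UNIV"
  unfolding pi_map_eq by (intro fm.subspace_sum fm.derived_subspace act_derived) auto

lemma pi_map_mult:
  fixes f g :: "('v, 'k::field_char_0) mpoly"
  shows "pi_map vs y (f * g) = pi_map vs y f \<star> g + pi_map vs y g \<star> f"
proof -
  have D: "comm y w \<in> fm.derived UNIV" for w by simp
  have "pdiff w (f * g) = pdiff w f * g + pdiff w g * f" for w
    by (simp add: pdiff_mult mult.commute)
  then have "comm y w \<star> pdiff w (f * g) = (comm y w \<star> pdiff w f) \<star> g + (comm y w \<star> pdiff w g) \<star> f" for w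
    by (simp only: act_add act_mult[OF D])
  then show ?thesis
    by (simp add: pi_map_eq sum.distrib act_sum_left act_derived)
qed

text \<open>The commutator \<open>comm y w\<close> contributes \<open>pvar w\<close> at
  \<open>y\<close> and \<open>- pvar y\<close> at \<open>w\<close>; at \<open>y\<close> the sum over
  \<open>w\<close> is Euler's identity.\<close>

lemma fox_pi_map:
  "fox v (pi_map vs y f) = (if v = y then deg_scale of_nat f else 0) - pvar y * pdiff v f"
proof -
  have D: "comm y w \<in> fm.derived UNIV" for w by simp
  have "fox v (pi_map vs y f) = (\<Sum>w\<in>UNIV. (if v = y then pvar w * pdiff w f else 0)
      - (if w = v then pvar y * pdiff w f else 0))"
    unfolding pi_map_eq fox_sum by (intro sum.cong refl) (simp add: fox_act[OF D] left_diff_distrib)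
  also have "\<dots> = (if v = y then (\<Sum>w\<in>UNIV. pvar w * pdiff w f) else 0) - pvar y * pdiff v f"
    by (simp add: sum_subtractf)
  finally show ?thesis by (simp add: euler_identity)
qed

section \<open>Subalgebras generated by variables\<close>

lemma lie_subalgebra_generated: "fm.lie_subalgebra (fm.lie_generated X)"
  unfolding fm.lie_generated_def
  by (rule hull_in) (auto simp: fm.lie_subalgebra_def intro: fm.subspace_Inter)

text \<open>Variables outside \<open>V\<close> have exponent 0 and act trivially; brackets with the
  other generators stay in the derived algebra of the subalgebra.\<close>

lemma ad_monomial_fm_derived:
  fixes u :: "('v, 'k::field) free_metab"
  assumes "u \<in> fm_derived V" "Poly_Mapping.keys m \<subseteq> V"
  shows "ad_monomial us u m \<in> fm_derived V"
proof -
  define S :: "('v, 'k) free_metab set" where "S = fm.lie_generated (fm_gen ` V)"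
  have S: "fm.lie_subalgebra S" unfolding S_def by (rule lie_subalgebra_generated)
  have derived_S: "fm.derived S \<subseteq> S"
    unfolding fm.derived_def using S by (intro fm.span_minimal) (auto simp: fm.lie_subalgebra_def)
  have brac: "fm_brac w (fm_gen v) \<in> fm.derived S" if "w \<in> fm.derived S" "v \<in> V" for w v
  proof -
    have "fm_gen v \<in> S"
      unfolding S_def fm.lie_generated_def using that by (intro hull_inc) auto
    then show ?thesis
      unfolding fm.derived_def[of S] using that derived_S by (intro fm.span_base) auto
  qed
  have "((\<lambda>w. fm_brac w (fm_gen v)) ^^ n) w \<in> fm.derived S" if "w \<in> fm.derived S" "v \<in> V" for w v n
    using that by (induction n) (auto simp: brac)
  moreover have "v \<in> V \<or> Poly_Mapping.lookup m v = 0" for v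
    using assms(2) by (auto simp: in_keys_iff)
  ultimately have "((\<lambda>w. fm_brac w (fm_gen v)) ^^ Poly_Mapping.lookup m v) w \<in> fm.derived S"
    if "w \<in> fm.derived S" for w v
    using that by (metis funpow_0)
  moreover have "u \<in> fm.derived S"
    using assms(1) by (simp add: fm_derived_def S_def)
  ultimately have "ad_monomial us u m \<in> fm.derived S"
    unfolding ad_monomial_def by (induction us arbitrary: u) auto
  then show ?thesis by (simp add: fm_derived_def S_def)
qed

lemma subspace_fm_derived: "fm.subspace (fm_derived V)"
  by (simp add: fm_derived_def fm.derived_subspace)

lemma fm_derived_subset: "fm_derived V \<subseteq> fm.derived UNIV"
  unfolding fm_derived_def fm.derived_def by (intro fm.span_mono) auto

lemma act_fm_derived:
  assumes "u \<in> fm_derived V" "f \<in> polys_in V"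
  shows "u \<star> f \<in> fm_derived V"
  unfolding fm_act_def using assms
  by (intro fm.subspace_sum fm.subspace_scale subspace_fm_derived ad_monomial_fm_derived)
    (auto simp: polys_in_def)

lemma comm_fm_derived: "v \<in> V \<Longrightarrow> w \<in> V \<Longrightarrow> comm v w \<in> fm_derived V"
  unfolding fm_derived_def fm.derived_def fm.lie_generated_def
  by (intro fm.span_base) (blast intro: hull_inc)

text \<open>A commutator with \<open>y\<close> occurs either next to \<open>t y = 0\<close> or next
  to a derivative by \<open>y\<close>, which vanishes on polynomials free of
  \<open>y\<close>.\<close>

lemma unfox_fm_derived:
  assumes "t y = 0" "\<And>v. t v \<in> polys_in (- {y})"
  shows "unfox t \<in> fm_derived (- {y})"
  unfolding unfox_def
proof (intro fm.subspace_sum subspace_fm_derived)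
  fix v w
  let ?g = "pdiff w (deg_scale (\<lambda>n. 1 / of_nat (Suc n)) (t v))"
  have g: "?g \<in> polys_in (- {y})"
    using assms(2) by (intro polys_in_pdiff polys_in_deg_scale)
  consider "v = y" | "w = y" | "v \<noteq> y" "w \<noteq> y" by blast
  then show "comm v w \<star> ?g \<in> fm_derived (- {y})"
  proof cases
    case 1
    then show ?thesis using assms(1) by (simp add: fm.subspace_0 subspace_fm_derived)
  next
    case 2
    have "deg_scale (\<lambda>n. 1 / of_nat (Suc n)) (t v) \<in> polys_in (- {y})"
      using assms(2) by (rule polys_in_deg_scale)
    from pdiff_polys_in[OF this] 2 have "?g = 0" by simp
    then show ?thesis by (simp add: fm.subspace_0 subspace_fm_derived)
  next
    case 3
    then show ?thesis using g by (intro act_fm_derived comm_fm_derived) auto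
  qed
qed

end

section \<open>Linear derivations of the free metabelian Lie algebra\<close>

text \<open>One matrix \<open>A\<close> describes both derivations on generators, so that they are
  compatible under the Fox derivatives.\<close>

locale linear_lie_derivation = variable_order vs + P: linear_poly_derivation D A
  for vs :: "'v::finite list" and D :: "('v, 'k::field_char_0) mpoly \<Rightarrow> ('v, 'k) mpoly" and A +
  fixes DL :: "('v, 'k) free_metab \<Rightarrow> ('v, 'k) free_metab"
  assumes lie_derivation: "fm.lie_derivation DL"
    and DL_gen: "DL (fm_gen w) = (\<Sum>v\<in>UNIV. fm_scale (A v w) (fm_gen v))"
begin

lemma DL_add: "DL (u + w) = DL u + DL w"
  and DL_scale: "DL (fm_scale c u) = fm_scale c (DL u)"
  and DL_brac: "DL (fm_brac u w) = fm_brac (DL u) w + fm_brac u (DL w)"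
  using lie_derivation by (auto simp: fm.lie_derivation_def Vector_Spaces.linear_iff)

lemma DL_zero [simp]: "DL 0 = 0"
  using DL_add[of 0 0] by simp

lemma DL_diff: "DL (u - w) = DL u - DL w"
  using DL_add[of "u - w" w] by (simp add: eq_diff_eq)

lemma fm_lin_DL: "fm_lin (DL u) = D (fm_lin u)"
  by (induction u rule: fm_induct)
    (simp_all add: DL_add DL_scale DL_brac DL_gen fm_lin_sum P.pvar P.add P.scale)

text \<open>On the wreath product the derivation acts by \<open>D\<close> on the polynomial
  coefficients and by \<open>A\<close> on the free module generators.\<close>

lemma fox_DL: "fox v (DL u) = D (fox v u) + (\<Sum>w\<in>UNIV. pm_scale (A v w) (fox w u))"
proof (induction u rule: fm_induct)
  case (gen w)
  have "fox v (DL (fm_gen w)) = (\<Sum>v'\<in>UNIV. if v' = v then pm_scale (A v w) 1 else 0)"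
    unfolding DL_gen fox_sum by (rule sum.cong) auto
  moreover have "(\<Sum>w'\<in>UNIV. pm_scale (A v w') (fox w' (fm_gen w))) =
      (\<Sum>w'\<in>UNIV. if w' = w then pm_scale (A v w) (1 :: ('v, 'k) mpoly) else 0)"
    by (rule sum.cong) auto
  ultimately show ?case by simp
next
  case (brac u w)
  define S where "S u = (\<Sum>z\<in>UNIV. pm_scale (A v z) (fox z u))" for u
  have S: "S (fm_brac u w) = S u * fm_lin w - S w * fm_lin u"
    by (simp add: S_def sum_distrib_right pm_scale_mult_left pm.scale_right_diff_distrib sum_subtractf)
  show ?case
    using brac unfolding S_def[symmetric] S DL_brac
    by (simp add: fm_lin_DL P.diff P.mult algebra_simps)
qed (simp_all add: DL_add DL_scale P.add P.scale pm.scale_right_distrib sum.distrib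
      pm.scale_sum_right mult.commute)

lemma DL_derived: "u \<in> fm.derived UNIV \<Longrightarrow> DL u \<in> fm.derived UNIV"
  unfolding fm.derived_def
proof (induction rule: fm.span_induct_alt)
  case (step c x y)
  then obtain a b where "x = fm_brac a b" by blast
  then have "DL x \<in> fm.derived UNIV"
    by (simp add: DL_brac fm.subspace_add fm.derived_subspace)
  then show ?case using step.IH
    unfolding fm.derived_def by (simp add: DL_add DL_scale fm.span_add fm.span_scale)
qed (simp add: fm.span_zero)

lemma DL_act:
  assumes "u \<in> fm.derived UNIV"
  shows "DL (u \<star> f) = DL u \<star> f + u \<star> D f"
proof (rule fox_inject)
  show "fox v (DL (u \<star> f)) = fox v (DL u \<star> f + u \<star> D f)" for v
  proof -
    have "(\<Sum>w\<in>UNIV. pm_scale (A v w) (fox w u * f)) = (\<Sum>w\<in>UNIV. pm_scale (A v w) (fox w u)) * f"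
      by (simp add: sum_distrib_right pm_scale_mult_left)
    then show ?thesis
      by (simp add: fox_DL fox_act assms DL_derived P.mult distrib_right)
  qed
qed (intro DL_derived act_derived assms fm.subspace_add fm.derived_subspace)+

lemma submodule_constants: "fm_submodule vs (poly_constants D UNIV) (fm_derived_constants DL UNIV)"
  by (auto simp: fm_submodule_def fm_derived_constants_def poly_constants_def fm_derived_UNIV
      fm.subspace_0 fm.subspace_add fm.derived_subspace DL_add DL_act act_derived)

end

lemma fm_submodule_hull: "fm_submodule vs R (fm_submodule vs R hull C)"
  by (rule hull_in) (auto simp: fm_submodule_def)

lemma submodule_sum:
  assumes "fm_submodule vs R N" "\<And>i. i \<in> I \<Longrightarrow> h i \<in> N"
  shows "(\<Sum>i\<in>I. h i) \<in> N"
  using assms by (induction I rule: infinite_finite_induct) (auto simp: fm_submodule_def)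

section \<open>Splitting off a constant variable\<close>

text \<open>The vanishing column makes \<open>y\<close> a constant, and the vanishing row keeps
  \<open>y\<close> out of the images of the other variables.\<close>

locale split_lie_derivation = linear_lie_derivation vs D A DL
  for vs :: "'v::finite list" and D :: "('v, 'k::field_char_0) mpoly \<Rightarrow> ('v, 'k) mpoly" and A DL +
  fixes y :: 'v
  assumes column: "A v y = 0" and row: "A y w = 0"
begin

lemma D_y [simp]: "D (pvar y) = 0"
  by (simp add: P.pvar column)

lemma D_y_power [simp]: "D (pvar y ^ n) = 0"
  by (induction n) (simp_all add: P.mult)

lemma y_power_constant: "pvar y ^ n \<in> poly_constants D UNIV"
  by (simp add: poly_constants_def polys_in_def)

lemma pi_map_constant:
  assumes "D f = 0"
  shows "pi_map vs y f \<in> fm_derived_constants DL UNIV"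
proof -
  have "DL (pi_map vs y f) = 0"
  proof (rule fox_inject)
    fix v
    \<comment> \<open>The Euler term of \<open>fox_pi_map\<close> occurs only for
      \<open>w = y\<close>, where the column of \<open>A\<close> is zero.\<close>
    have "pm_scale (A v w) (fox w (pi_map vs y f)) = - (pvar y * pm_scale (A v w) (pdiff w f))" for w
      by (cases "w = y") (simp_all add: fox_pi_map column pm_scale_mult_right)
    moreover have "D (fox v (pi_map vs y f)) = - (pvar y * D (pdiff v f))"
      by (simp add: fox_pi_map P.diff P.mult P.deg_scale assms)
    ultimately have "fox v (DL (pi_map vs y f)) =
        - (pvar y * (D (pdiff v f) + (\<Sum>w\<in>UNIV. pm_scale (A v w) (pdiff w f))))"
      by (simp add: fox_DL sum_negf sum_distrib_left distrib_left)
    then show "fox v (DL (pi_map vs y f)) = fox v 0"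
      by (simp add: P.pdiff[symmetric] assms)
  qed (simp_all add: DL_derived pi_map_derived fm.subspace_0 fm.derived_subspace)
  then show ?thesis
    by (simp add: fm_derived_constants_def fm_derived_UNIV pi_map_derived)
qed

text \<open>The coefficients of a fixed power of \<open>y\<close> in the Fox derivatives again form
  a cycle, without \<open>y\<close>-component and free of \<open>y\<close>. By \<open>unfox\<close>
  it comes from a constant in the other variables.\<close>

lemma constant_fox_y_zero:
  assumes u: "u \<in> fm_derived_constants DL UNIV" and y: "fox y u = 0"
    and N: "fm_submodule vs (poly_constants D UNIV) N" "fm_derived_constants DL (- {y}) \<subseteq> N"
  shows "u \<in> N"
proof -
  have uD: "u \<in> fm.derived UNIV" "DL u = 0"
    using u by (auto simp: fm_derived_constants_def fm_derived_UNIV)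
  have "\<exists>M. \<forall>M'\<ge>M. fox v u = (\<Sum>n<M'. pvar y ^ n * pcoeff y n (fox v u))" for v
    using pcoeff_expansion[of "fox v u" y] by metis
  then obtain M where "\<And>v M'. M' \<ge> M v \<Longrightarrow> fox v u = (\<Sum>n<M'. pvar y ^ n * pcoeff y n (fox v u))"
    by metis
  \<comment> \<open>The sum of the individual bounds is a common one.\<close>
  moreover have "M v \<le> sum M UNIV" for v
    by (rule member_le_sum) auto
  ultimately have expansion: "fox v u = (\<Sum>n<sum M UNIV. pvar y ^ n * pcoeff y n (fox v u))" for v
    by blast
  define w where "w n = unfox (\<lambda>v. pcoeff y n (fox v u))" for n
  have w_derived: "w n \<in> fm.derived UNIV" for n
    by (simp add: w_def unfox_derived)
  have fox_w: "fox v (w n) = pcoeff y n (fox v u)" for v n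
    unfolding w_def
  proof (rule fox_unfox)
    \<comment> \<open>The summand for \<open>y\<close>, where the coefficient would shift, is zero
      on both sides.\<close>
    have "(\<Sum>v\<in>UNIV. pvar v * pcoeff y n (fox v u)) = (\<Sum>v\<in>UNIV. pcoeff y n (pvar v * fox v u))"
      using y by (intro sum.cong refl) (metis mult_zero_right pcoeff_pvar_mult pcoeff_zero)
    also have "\<dots> = pcoeff y n (fm_lin u)"
      by (simp add: pcoeff_sum[symmetric] fox_fundamental)
    finally show "(\<Sum>v\<in>UNIV. pvar v * pcoeff y n (fox v u)) = 0"
      by (simp add: fm_lin_derived[OF uD(1)])
  qed
  have "DL (w n) = 0" for n
  proof (rule fox_inject)
    fix v
    have "fox v (DL (w n)) = pcoeff y n (fox v (DL u))"
      by (simp add: fox_DL fox_w P.pcoeff[OF column row] pcoeff_add pcoeff_sum pcoeff_pm_scale)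
    then show "fox v (DL (w n)) = fox v 0" by (simp add: uD)
  qed (simp_all add: DL_derived w_derived fm.subspace_0 fm.derived_subspace)
  moreover have "w n \<in> fm_derived (- {y})" for n
    unfolding w_def using y by (intro unfox_fm_derived) (simp_all add: pcoeff_in_polys)
  ultimately have "w n \<star> pvar y ^ n \<in> N" for n
    using N y_power_constant unfolding fm_submodule_def fm_derived_constants_def by blast
  then have "(\<Sum>n<sum M UNIV. w n \<star> pvar y ^ n) \<in> N"
    by (intro submodule_sum[OF N(1)])
  also have "(\<Sum>n<sum M UNIV. w n \<star> pvar y ^ n) = u"
  proof (rule fox_inject)
    show "fox v (\<Sum>n<sum M UNIV. w n \<star> pvar y ^ n) = fox v u" for v
      using expansion[of v] by (simp add: fox_sum fox_act w_derived fox_w mult.commute)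
  qed (simp_all add: uD act_derived w_derived fm.subspace_sum fm.derived_subspace)
  finally show ?thesis .
qed

lemma fox_y_pcoeff_constant_term:
  assumes "u \<in> fm.derived UNIV"
  shows "Poly_Mapping.lookup (pcoeff y n (fox y u)) 0 = 0"
proof -
  have "pvar y * fox y u + (\<Sum>v\<in>- {y}. pvar v * fox v u) = 0"
    using fox_fundamental[of u] fm_lin_derived[OF assms]
    by (simp add: sum.remove[of UNIV y] Compl_eq_Diff_UNIV)
  \<comment> \<open>The factor \<open>pvar y\<close> raises the power by one. All other summands are
    multiples of a variable different from \<open>y\<close>, so they have no constant term.\<close>
  then have "pcoeff y (Suc n) (pvar y * fox y u + (\<Sum>v\<in>- {y}. pvar v * fox v u)) = 0"
    by simp
  then have "pcoeff y n (fox y u) + (\<Sum>v\<in>- {y}. pvar v * pcoeff y (Suc n) (fox v u)) = 0"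
    by (simp add: pcoeff_add pcoeff_sum pcoeff_pvar_mult_same pcoeff_pvar_mult)
  then have "Poly_Mapping.lookup (pcoeff y n (fox y u) +
      (\<Sum>v\<in>- {y}. pvar v * pcoeff y (Suc n) (fox v u))) 0 = 0"
    by simp
  then show ?thesis
    by (simp add: lookup_add lookup_sum lookup_pvar_mult)
qed

theorem constants_generated:
  assumes C: "generates_module vs (poly_constants D (- {y})) (fm_derived_constants DL (- {y})) C"
    and F: "generates_algebra (poly_constants D (- {y})) F"
  shows "generates_module vs (poly_constants D UNIV) (fm_derived_constants DL UNIV)
    (C \<union> pi_map vs y ` F)"
proof -
  let ?R = "poly_constants D UNIV" and ?R' = "poly_constants D (- {y})"
  let ?N = "fm_derived_constants DL UNIV" and ?N' = "fm_derived_constants DL (- {y})"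
  define H where "H = fm_submodule vs ?R hull (C \<union> pi_map vs y ` F)"
  have H: "fm_submodule vs ?R H" unfolding H_def by (rule fm_submodule_hull)
  have H_sub: "C \<union> pi_map vs y ` F \<subseteq> H" unfolding H_def by (rule hull_subset)
  have CN': "fm_submodule vs ?R' hull C = ?N'" and FR': "poly_subalgebra hull F = ?R'"
    using C F by (simp_all add: generates_module_def generates_algebra_def)
  have R'R: "?R' \<subseteq> ?R" by (auto simp: poly_constants_def polys_in_def)
  have N'N: "?N' \<subseteq> ?N"
    using fm_derived_subset by (auto simp: fm_derived_constants_def fm_derived_UNIV)
  have "C \<subseteq> ?N" using hull_subset[of C "fm_submodule vs ?R'"] CN' N'N by blast
  moreover have "F \<subseteq> ?R'" using hull_subset[of F poly_subalgebra] FR' by simp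
  ultimately have HN: "H \<subseteq> ?N"
    unfolding H_def using pi_map_constant
    by (intro hull_minimal submodule_constants) (auto simp: poly_constants_def)
  have "fm_submodule vs ?R' H"
    using H R'R unfolding fm_submodule_def by blast
  then have N'H: "?N' \<subseteq> H"
    unfolding CN'[symmetric] using H_sub by (intro hull_minimal) auto
  \<comment> \<open>Constant polynomials act as scalars, which yields the closure under scaling that
    \<open>fm_submodule\<close> does not list.\<close>
  have const: "Poly_Mapping.single 0 a \<in> ?R" for a
    by (simp add: poly_constants_def polys_in_def)
  \<comment> \<open>A subalgebra that contains \<open>F\<close> is all of \<open>?R'\<close>, so
    \<pi> maps every constant in the other variables into \<open>H\<close>.\<close>
  have "poly_subalgebra {f \<in> ?R'. pi_map vs y f \<in> H}"
    unfolding poly_subalgebra_def pm.subspace_def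
  proof (intro conjI ballI allI)
    have "pi_map vs y (0 :: ('v, 'k) mpoly) = 0" "pi_map vs y (1 :: ('v, 'k) mpoly) = 0"
      by (simp_all add: pi_map_eq pdiff_one)
    then show "0 \<in> {f \<in> ?R'. pi_map vs y f \<in> H}" "1 \<in> {f \<in> ?R'. pi_map vs y f \<in> H}"
      using H P.constants_subalgebra[of "- {y}"]
      by (auto simp: poly_subalgebra_def pm.subspace_def fm_submodule_def)
  next
    fix f g assume fg: "f \<in> {f \<in> ?R'. pi_map vs y f \<in> H}" "g \<in> {f \<in> ?R'. pi_map vs y f \<in> H}"
    then show "f + g \<in> {f \<in> ?R'. pi_map vs y f \<in> H}"
      using H P.constants_subalgebra[of "- {y}"]
      by (auto simp: poly_subalgebra_def pm.subspace_def fm_submodule_def pi_map_add)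
    have "f \<in> ?R" "g \<in> ?R" using fg R'R by auto
    with fg show "f * g \<in> {f \<in> ?R'. pi_map vs y f \<in> H}"
      using H P.constants_subalgebra[of "- {y}"]
      by (auto simp: poly_subalgebra_def fm_submodule_def pi_map_mult)
  next
    fix a f assume f: "f \<in> {f \<in> ?R'. pi_map vs y f \<in> H}"
    have "pi_map vs y (pm_scale a f) = pi_map vs y f \<star> Poly_Mapping.single 0 a"
      by (simp add: pi_map_eq pdiff_pm_scale act_const fm.scale_sum_right fm_scale_act)
    then show "pm_scale a f \<in> {f \<in> ?R'. pi_map vs y f \<in> H}"
      using f H const[of a] P.constants_subalgebra[of "- {y}"]
      by (auto simp: poly_subalgebra_def pm.subspace_def fm_submodule_def)
  qed
  then have "?R' \<subseteq> {f \<in> ?R'. pi_map vs y f \<in> H}"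
    using H_sub \<open>F \<subseteq> ?R'\<close> by (subst FR'[symmetric], intro hull_minimal) auto
  then have piH: "pi_map vs y f \<in> H" if "f \<in> ?R'" for f using that by blast
  have "?N \<subseteq> H"
  proof
    fix u assume u: "u \<in> ?N"
    then have uD: "u \<in> fm.derived UNIV" "DL u = 0"
      by (auto simp: fm_derived_constants_def fm_derived_UNIV)
    define h where "h = fox y u"
    \<comment> \<open>The inverse of the Euler operator. In degree 0 the weight is
      \<open>1 / 0 = 0\<close>, which is harmless as the constant term vanishes.\<close>
    define g where "g n = deg_scale (\<lambda>i. 1 / of_nat i) (pcoeff y n h)" for n
    have Dh: "D h = 0"
      using fox_DL[of y u] by (simp add: uD row h_def)
    have g: "g n \<in> ?R'" for n
      by (simp add: g_def poly_constants_def polys_in_deg_scale pcoeff_in_polys P.deg_scale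
          P.pcoeff[OF column row] Dh)
    have Eg: "deg_scale of_nat (g n) = pcoeff y n h" for n
    proof (rule poly_mapping_eqI)
      fix m :: "'v \<Rightarrow>\<^sub>0 nat"
      show "Poly_Mapping.lookup (deg_scale of_nat (g n)) m = Poly_Mapping.lookup (pcoeff y n h) m"
      proof (cases "mdeg m = 0")
        case True
        then have "m = 0" by (intro poly_mapping_eqI) (simp add: mdeg_def)
        then show ?thesis
          using fox_y_pcoeff_constant_term[OF uD(1), of n] by (simp add: lookup_deg_scale h_def)
      qed (simp add: g_def lookup_deg_scale)
    qed
    obtain M where M: "h = (\<Sum>n<M. pvar y ^ n * pcoeff y n h)"
      using pcoeff_expansion[of h y] by blast
    define s where "s = (\<Sum>n<M. pi_map vs y (g n) \<star> pvar y ^ n)"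
    have sH: "s \<in> H"
      unfolding s_def using H piH[OF g] y_power_constant
      by (intro submodule_sum[OF H]) (auto simp: fm_submodule_def)
    \<comment> \<open>This leaves only the Euler term in the \<open>y\<close>-component of
      \<pi>.\<close>
    have "pdiff y (g n) = 0" for n
      using g by (intro pdiff_polys_in) (auto simp: poly_constants_def)
    then have "fox y s = (\<Sum>n<M. pvar y ^ n * pcoeff y n h)"
      by (simp add: s_def fox_sum fox_act pi_map_derived fox_pi_map Eg mult.commute)
    then have "fox y s = h"
      by (simp only: M[symmetric])
    moreover have "u - s \<in> ?N"
      using u sH HN by (auto simp: fm_derived_constants_def fm_derived_UNIV DL_diff
          fm.subspace_diff fm.derived_subspace)
    ultimately have "u - s \<in> H"
      using constant_fox_y_zero[OF _ _ H N'H] by (simp add: h_def)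
    then have "(u - s) + s \<in> H"
      using sH H unfolding fm_submodule_def by blast
    then show "u \<in> H" by simp
  qed
  with HN show ?thesis
    unfolding generates_module_def H_def by blast
qed

end

section \<open>From the last Jordan cell to the vanishing row and column\<close>

lemma jordan_matrix_last_block:
  assumes "i \<le> sum_list (map fst cells)"
  defines "n \<equiv> sum_list (map fst cells)"
  shows "jordan_matrix (cells @ [(1, 0)]) $$ (i, n) = (0 :: 'k::field)"
    and "jordan_matrix (cells @ [(1, 0)]) $$ (n, i) = (0 :: 'k::field)"
proof -
  have "jordan_matrix (cells @ [(1, 0)]) $$ (i, n) = (0 :: 'k) \<and>
      jordan_matrix (cells @ [(1, 0)]) $$ (n, i) = (0 :: 'k)"
    using assms(1) unfolding n_def
  proof (induction cells arbitrary: i)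
    case Nil
    then show ?case
      by (simp add: jordan_matrix_def Let_def jordan_block_def)
  next
    case (Cons c cells)
    obtain m a where c: "c = (m, a)" by (cases c)
    let ?J = "jordan_matrix (cells @ [(1, 0)]) :: 'k mat"
    have J: "jordan_matrix ((m, a) # cells @ [(1, 0)]) =
        four_block_mat (jordan_block m a) (0\<^sub>m m (sum_list (map fst cells) + 1))
          (0\<^sub>m (sum_list (map fst cells) + 1) m) ?J"
      using jordan_matrix_dim[of "cells @ [(1, 0 :: 'k)]"]
      by (simp add: jordan_matrix_def Let_def)
    \<comment> \<open>For \<open>i < m\<close> the entries lie in the zero blocks; otherwise
      \<open>i - m\<close> is the index inside the remaining matrix.\<close>
    show ?case
      using Cons.IH[of "i - m"] Cons.prems unfolding c append_Cons J by auto
  qed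
  then show "jordan_matrix (cells @ [(1, 0)]) $$ (i, n) = (0 :: 'k)"
    and "jordan_matrix (cells @ [(1, 0)]) $$ (n, i) = (0 :: 'k)" by auto
qed

theorem corollary4p4:
  fixes x :: "nat \<Rightarrow> 'v::finite" and d k l :: nat
    and \<delta> :: "('v \<Rightarrow>\<^sub>0 'k::field_char_0) \<Rightarrow> ('v \<Rightarrow>\<^sub>0 'k)"
    and \<delta>P :: "('v, 'k) mpoly \<Rightarrow> ('v, 'k) mpoly"
    and \<delta>L :: "('v, 'k) free_metab \<Rightarrow> ('v, 'k) free_metab"
    and cells :: "(nat \<times> 'k) list"
    and c :: "nat \<Rightarrow> ('v, 'k) free_metab"
    and f :: "nat \<Rightarrow> ('v, 'k) mpoly"
  assumes variables: "bij_betw x {1..d} UNIV"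
    and weitzenboeck: "weitzenboeck \<delta> \<delta>P \<delta>L"
    and jordan: "jordan_basis x d \<delta> (cells @ [(1, 0)])"
    and c_homogeneous: "\<forall>i\<in>{1..k}. \<exists>n. fm_homogeneous n (c i)"
    and c_generates: "generates_module (map x [1..<Suc d])
          (poly_constants \<delta>P (x ` {1..d - 1}))
          (fm_derived_constants \<delta>L (x ` {1..d - 1})) (c ` {1..k})"
    and f_homogeneous: "\<forall>i\<in>{1..l}. \<exists>n\<ge>1. poly_homogeneous n (f i)"
    and f_generates: "generates_algebra (poly_constants \<delta>P (x ` {1..d - 1})) (f ` {1..l})"
  shows "generates_module (map x [1..<Suc d])
           (poly_constants \<delta>P (x ` {1..d}))
           (fm_derived_constants \<delta>L (x ` {1..d}))
           (c ` {1..k} \<union> (\<lambda>i. pi_map (map x [1..<Suc d]) (x d) (f i)) ` {1..l})"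
proof -
  define A where "A v w = Poly_Mapping.lookup (\<delta> (Poly_Mapping.single w 1)) v" for v w
  have inj: "inj_on x {1..d}" and range: "x ` {1..d} = UNIV"
    using variables by (auto simp: bij_betw_def)
  have matrix: "operator_matrix x d \<delta> = jordan_matrix (cells @ [(1, 0)])"
    using jordan by (simp add: jordan_basis_def)
  \<comment> \<open>Comparing dimensions makes \<open>d\<close> positive and puts the last cell at
    matrix index \<open>d - 1\<close>.\<close>
  have d: "d = Suc (sum_list (map fst cells))"
    using arg_cong[OF matrix, of dim_row] by (simp add: operator_matrix_def)
  have entry: "A (x (Suc i)) (x (Suc j)) = jordan_matrix (cells @ [(1, 0)]) $$ (i, j)"
    if "i < d" "j < d" for i j
    unfolding matrix[symmetric] operator_matrix_def A_def using that by simp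
  have surj: "\<exists>i<d. v = x (Suc i)" for v
  proof -
    obtain i where "i \<in> {1..d}" "v = x i" using range by blast
    then show ?thesis by (intro exI[of _ "i - 1"]) auto
  qed
  have y_row: "A (x d) w = 0" and y_col: "A w (x d) = 0" for w
  proof -
    obtain i where "i < d" "w = x (Suc i)" using surj by blast
    then show "A (x d) w = 0" "A w (x d) = 0"
      using entry[of i "d - 1"] entry[of "d - 1" i] jordan_matrix_last_block[of i cells]
      by (simp_all add: d)
  qed
  have complement: "x ` {1..d - 1} = - {x d}"
  proof -
    have "{1..d - 1} = {1..d} - {d}" by (auto simp: d)
    then show ?thesis
      using inj range by (simp add: inj_on_image_set_diff[OF inj] Compl_eq_Diff_UNIV d)
  qed
  \<comment> \<open>Sums over the support are extended by zero terms to the sums over all variables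
    used in the locales.\<close>
  have poly_form: "poly_linear_form w = (\<Sum>v\<in>UNIV. pm_scale (Poly_Mapping.lookup w v) (pvar v))"
    for w :: "'v \<Rightarrow>\<^sub>0 'k"
    unfolding poly_linear_form_def by (rule sum.mono_neutral_left) (auto simp: in_keys_iff)
  have lie_form: "fm_linear_form w = (\<Sum>v\<in>UNIV. fm_scale (Poly_Mapping.lookup w v) (fm_gen v))"
    for w :: "'v \<Rightarrow>\<^sub>0 'k"
    unfolding fm_linear_form_def by (rule sum.mono_neutral_left) (auto simp: in_keys_iff)
  have gen_forms: "poly_linear_form (Poly_Mapping.single w (1 :: 'k)) = pvar w"
    "fm_linear_form (Poly_Mapping.single w (1 :: 'k)) = fm_gen w" for w :: 'v
    by (simp_all add: poly_linear_form_def fm_linear_form_def)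
  interpret split_lie_derivation "map x [1..<Suc d]" \<delta>P A \<delta>L "x d"
  proof unfold_locales
    show "distinct (map x [1..<Suc d])"
      using inj by (simp add: distinct_map atLeastLessThanSuc_atLeastAtMost del: upt_Suc)
    show "set (map x [1..<Suc d]) = UNIV"
      using range by (simp add: atLeastLessThanSuc_atLeastAtMost del: upt_Suc)
    show "poly_derivation \<delta>P" "fm.lie_derivation \<delta>L"
      using weitzenboeck by (simp_all add: weitzenboeck_def)
    show "\<delta>P (pvar w) = (\<Sum>v\<in>UNIV. pm_scale (A v w) (pvar v))" for w
      using weitzenboeck gen_forms(1)[of w] poly_form unfolding weitzenboeck_def A_def by metis
    show "\<delta>L (fm_gen w) = (\<Sum>v\<in>UNIV. fm_scale (A v w) (fm_gen v))" for w
      using weitzenboeck gen_forms(2)[of w] lie_form unfolding weitzenboeck_def A_def by metis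
    show "A v (x d) = 0" "A (x d) w = 0" for v w
      by (rule y_col, rule y_row)
  qed
  show ?thesis
    using constants_generated c_generates f_generates
    unfolding complement range image_image[symmetric, of "pi_map (map x [1..<Suc d]) (x d)" f] .
qed

end
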